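(* Let $\alpha,\beta$ be integers with $\beta \geq \alpha + 1$, $\alpha \geq 3$ and $\beta \geq 5$. Then the groups \[ \Gamma^{2^{\alpha}, 2^{\beta}}(3,\ 1+2^{\beta-2},\ -3,\ -1+2^{\beta-2}) \quad\text{and}\quad \Gamma^{2^{\alpha}, 2^{\beta}}(3,\ 1-2^{\beta-2},\ -3,\ -1-2^{\beta-2}) \] are the automorphism groups of tight chiral polyhedra of type $\{2^{\alpha}, 2^{\beta}\}$.
   Context: For integers $p,q,i_1,j_1,i_2,j_2$, $\Gamma^{p,q}(i_1,j_1,i_2,j_2)$ denotes the group with presentation $\langle \sigma_1,\sigma_2 \mid \sigma_1^p=\sigma_2^q=(\sigma_1\sigma_2)^2=1,\ \sigma_2^{-1}\sigma_1=\sigma_1^{i_1}\sigma_2^{j_1},\ \sigma_2\sigma_1^{-1}=\sigma_1^{i_2}\sigma_2^{j_2}\rangle$. An (abstract) polyhedron is a partially ordered set whose elements have rank $0$, $1$, $2$ (vertices, edges, faces), incidence meaning comparability, such that every edge is incident to exactly two vertices and two faces, whenever a vertex is incident to a face exactly two edges are incident to both, the incidence graph is connected, and for each vertex or face the subgraph of the incidence graph induced on its neighbours is connected. A flag is a mutually incident (vertex, edge, face) triple; $\Phi^i$ is the flag differing from $\Phi$ exactly in its rank-$i$ element. Type $\{p,q\}$: faces are incident to $p$ edges and vertices to $q$ edges. The polyhedron is chiral if its flags split into two classes with $\Phi,\Phi^i$ always in different classes and the automorphism group transitive on each class but not on all flags; then, fixing a base flag $\Phi$, the automorphism group is generated by $\sigma_1:\Phi\mapsto(\Phi^1)^0$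 and $\sigma_2:\Phi\mapsto(\Phi^2)^1$. A group $\langle\sigma_1,\sigma_2\rangle$ "is the automorphism group of" such a polyhedron if there is an isomorphism onto it sending the generators $\sigma_1,\sigma_2$ to these distinguished generators. A polyhedron of type $\{p,q\}$ is tight if it has exactly $2pq$ flags. *)

theory Defs
  imports "HOL-Algebra.Bij"
begin

section \<open>Groups given by generators and relations\<close>

text \<open>The letter \<^term>\<open>(x, True)\<close> stands for the generator \<^term>\<open>x\<close>,
  \<^term>\<open>(x, False)\<close> for its formal inverse. Relations are pairs of words (left side, right side).\<close>

type_synonym 'x word = "('x \<times> bool) list"

inductive word_eq :: "('x word \<times> 'x word) set \<Rightarrow> 'x word \<Rightarrow> 'x word \<Rightarrow> bool"
  for R :: "('x word \<times> 'x word) set" where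
  refl: "word_eq R w w"
| sym: "word_eq R v w \<Longrightarrow> word_eq R w v"
| trans: "word_eq R u v \<Longrightarrow> word_eq R v w \<Longrightarrow> word_eq R u w"
| cancel: "word_eq R (u @ [(x, b), (x, \<not> b)] @ v) (u @ v)"
| rel: "(r, s) \<in> R \<Longrightarrow> word_eq R (u @ r @ v) (u @ s @ v)"

definition word_class :: "('x word \<times> 'x word) set \<Rightarrow> 'x word \<Rightarrow> 'x word set" where
  "word_class R w = {v. word_eq R w v}"

definition presented_group :: "('x word \<times> 'x word) set \<Rightarrow> 'x word set monoid" where
  "presented_group R =
    \<lparr>carrier = range (word_class R),
     mult = (\<lambda>A B. \<Union>a\<in>A. \<Union>b\<in>B. word_class R (a @ b)),
     one = word_class R []\<rparr>"

definition presented_gen :: "('x word \<times> 'x word) set \<Rightarrow> 'x \<Rightarrow> 'x word set" where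
  "presented_gen R x = word_class R [(x, True)]"

lemma word_eq_append_left: "word_eq R v w \<Longrightarrow> word_eq R (u @ v) (u @ w)"
proof (induction rule: word_eq.induct)
  case (cancel u' x b v)
  show ?case using word_eq.cancel[of R "u @ u'" x b v] by simp
next
  case (rel r s u' v)
  then show ?case using word_eq.rel[of r s R "u @ u'" v] by simp
qed (auto intro: word_eq.intros)

lemma word_eq_append_right: "word_eq R v w \<Longrightarrow> word_eq R (v @ u) (w @ u)"
proof (induction rule: word_eq.induct)
  case (cancel u' x b v)
  show ?case using word_eq.cancel[of R u' x b "v @ u"] by simp
next
  case (rel r s u' v)
  then show ?case using word_eq.rel[of r s R u' "v @ u"] by simp
qed (auto intro: word_eq.intros)

lemma word_eq_append: "word_eq R u u' \<Longrightarrow> word_eq R v v' \<Longrightarrow> word_eq R (u @ v) (u' @ v')"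
  by (blast intro: word_eq.trans word_eq_append_left word_eq_append_right)

lemma word_class_eq_iff: "word_class R v = word_class R w \<longleftrightarrow> word_eq R v w"
  unfolding word_class_def set_eq_iff mem_Collect_eq
  by (metis word_eq.refl word_eq.sym word_eq.trans)

lemma presented_group_mult:
  "word_class R v \<otimes>\<^bsub>presented_group R\<^esub> word_class R w = word_class R (v @ w)"
proof -
  have "word_class R (a @ b) = word_class R (v @ w)"
    if "a \<in> word_class R v" "b \<in> word_class R w" for a b
  proof -
    have "word_eq R (v @ w) (a @ b)"
      using that by (intro word_eq_append) (simp_all add: word_class_def)
    then show ?thesis
      by (simp only: word_class_eq_iff) (rule word_eq.sym)
  qed
  moreover have "v \<in> word_class R v" "w \<in> word_class R w"
    by (auto simp: word_class_def intro: word_eq.refl)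
  ultimately show ?thesis
    unfolding presented_group_def monoid.simps by blast
qed

definition word_inv :: "'x word \<Rightarrow> 'x word" where
  "word_inv w = rev (map (\<lambda>(x, b). (x, \<not> b)) w)"

lemma word_eq_inv_left: "word_eq R (word_inv w @ w) []"
proof (induction w)
  case Nil
  show ?case by (simp add: word_inv_def word_eq.refl)
next
  case (Cons a w)
  obtain x b where a: "a = (x, b)" by (cases a)
  show ?case
    using word_eq.trans[OF word_eq.cancel[of R "word_inv w" x "\<not> b" w] Cons.IH]
    by (simp add: a word_inv_def)
qed

lemma group_presented_group: "group (presented_group R)"
proof (rule groupI)
  fix x y z
  assume "x \<in> carrier (presented_group R)" "y \<in> carrier (presented_group R)"
    "z \<in> carrier (presented_group R)"
  then obtain u v w where "x = word_class R u" "y = word_class R v" "z = word_class R w"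
    by (auto simp: presented_group_def)
  then show "x \<otimes>\<^bsub>presented_group R\<^esub> y \<otimes>\<^bsub>presented_group R\<^esub> z =
      x \<otimes>\<^bsub>presented_group R\<^esub> (y \<otimes>\<^bsub>presented_group R\<^esub> z)"
    by (simp add: presented_group_mult)
next
  fix x y
  assume "x \<in> carrier (presented_group R)" "y \<in> carrier (presented_group R)"
  then obtain u v where "x = word_class R u" "y = word_class R v"
    by (auto simp: presented_group_def)
  then show "x \<otimes>\<^bsub>presented_group R\<^esub> y \<in> carrier (presented_group R)"
    by (simp add: presented_group_mult) (simp add: presented_group_def)
next
  show "\<one>\<^bsub>presented_group R\<^esub> \<in> carrier (presented_group R)"
    by (simp add: presented_group_def)
next
  fix x assume "x \<in> carrier (presented_group R)"
  then obtain u where u: "x = word_class R u" by (auto simp: presented_group_def)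
  have one: "\<one>\<^bsub>presented_group R\<^esub> = word_class R []" by (simp add: presented_group_def)
  show "\<one>\<^bsub>presented_group R\<^esub> \<otimes>\<^bsub>presented_group R\<^esub> x = x"
    by (simp add: u one presented_group_mult)
  have "word_class R (word_inv u) \<otimes>\<^bsub>presented_group R\<^esub> x = \<one>\<^bsub>presented_group R\<^esub>"
    by (simp add: u one presented_group_mult word_class_eq_iff word_eq_inv_left)
  moreover have "word_class R (word_inv u) \<in> carrier (presented_group R)"
    by (simp add: presented_group_def)
  ultimately show "\<exists>y\<in>carrier (presented_group R).
      y \<otimes>\<^bsub>presented_group R\<^esub> x = \<one>\<^bsub>presented_group R\<^esub>"
    by blast
qed


section \<open>The groups $\Gamma^{p,q}(i_1,j_1,i_2,j_2)$\<close>

datatype gen = S1 | S2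

definition gen_pow :: "gen \<Rightarrow> int \<Rightarrow> gen word" where
  "gen_pow x k = replicate (nat \<bar>k\<bar>) (x, 0 \<le> k)"

definition Gamma_rels :: "int \<Rightarrow> int \<Rightarrow> int \<Rightarrow> int \<Rightarrow> int \<Rightarrow> int \<Rightarrow> (gen word \<times> gen word) set" where
  "Gamma_rels p q i1 j1 i2 j2 =
    {(gen_pow S1 p, []),
     (gen_pow S2 q, []),
     (gen_pow S1 1 @ gen_pow S2 1 @ gen_pow S1 1 @ gen_pow S2 1, []),
     (gen_pow S2 (-1) @ gen_pow S1 1, gen_pow S1 i1 @ gen_pow S2 j1),
     (gen_pow S2 1 @ gen_pow S1 (-1), gen_pow S1 i2 @ gen_pow S2 j2)}"

definition Gamma :: "int \<Rightarrow> int \<Rightarrow> int \<Rightarrow> int \<Rightarrow> int \<Rightarrow> int \<Rightarrow> gen word set monoid" where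
  "Gamma p q i1 j1 i2 j2 = presented_group (Gamma_rels p q i1 j1 i2 j2)"

definition Gamma_gen :: "int \<Rightarrow> int \<Rightarrow> int \<Rightarrow> int \<Rightarrow> int \<Rightarrow> int \<Rightarrow> gen \<Rightarrow> gen word set" where
  "Gamma_gen p q i1 j1 i2 j2 = presented_gen (Gamma_rels p q i1 j1 i2 j2)"


section \<open>Abstract polyhedra\<close>

record 'a ranked_poset =
  elems :: "'a set"
  ord_rel :: "('a \<times> 'a) set"
  rank_of :: "'a \<Rightarrow> nat"

text \<open>Incidence of distinct elements, i.e. adjacency in the incidence graph.\<close>

definition incident :: "'a ranked_poset \<Rightarrow> 'a \<Rightarrow> 'a \<Rightarrow> bool" where
  "incident X x y \<longleftrightarrow> x \<in> elems X \<and> y \<in> elems X \<and> x \<noteq> y \<and>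
     ((x, y) \<in> ord_rel X \<or> (y, x) \<in> ord_rel X)"

definition rank_set :: "'a ranked_poset \<Rightarrow> nat \<Rightarrow> 'a set" where
  "rank_set X i = {x \<in> elems X. rank_of X x = i}"

abbreviation "vertices X \<equiv> rank_set X 0"
abbreviation "edges X \<equiv> rank_set X 1"
abbreviation "faces X \<equiv> rank_set X 2"

definition neighbours :: "'a ranked_poset \<Rightarrow> 'a \<Rightarrow> 'a set" where
  "neighbours X x = {y. incident X x y}"

definition induced_connected :: "'a ranked_poset \<Rightarrow> 'a set \<Rightarrow> bool" where
  "induced_connected X V \<longleftrightarrow> V \<noteq> {} \<and>
     (\<forall>x\<in>V. \<forall>y\<in>V. (x, y) \<in> {(u, v). u \<in> V \<and> v \<in> V \<and> incident X u v}\<^sup>*)"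

definition polyhedron :: "'a ranked_poset \<Rightarrow> bool" where
  "polyhedron X \<longleftrightarrow>
     partial_order_on (elems X) (ord_rel X) \<and>
     (\<forall>x\<in>elems X. rank_of X x \<in> {0, 1, 2}) \<and>
     (\<forall>(x, y)\<in>ord_rel X. x \<noteq> y \<longrightarrow> rank_of X x < rank_of X y) \<and>
     (\<forall>e\<in>edges X. card {v \<in> vertices X. incident X v e} = 2 \<and>
                    card {f \<in> faces X. incident X e f} = 2) \<and>
     (\<forall>v\<in>vertices X. \<forall>f\<in>faces X. incident X v f \<longrightarrow>
        card {e \<in> edges X. incident X v e \<and> incident X e f} = 2) \<and>
     induced_connected X (elems X) \<and>
     (\<forall>x\<in>vertices X \<union> faces X. induced_connected X (neighbours X x))"

type_synonym 'a flag = "'a \<times> 'a \<times> 'a"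

definition flags :: "'a ranked_poset \<Rightarrow> 'a flag set" where
  "flags X = {(v, e, f). v \<in> vertices X \<and> e \<in> edges X \<and> f \<in> faces X \<and>
     incident X v e \<and> incident X e f \<and> incident X v f}"

fun flag_elem :: "'a flag \<Rightarrow> nat \<Rightarrow> 'a" where
  "flag_elem (v, e, f) i = [v, e, f] ! i"

definition adj_flag :: "'a ranked_poset \<Rightarrow> nat \<Rightarrow> 'a flag \<Rightarrow> 'a flag" where
  "adj_flag X i \<Phi> = (THE \<Psi>. \<Psi> \<in> flags X \<and>
     (\<forall>j\<in>{0, 1, 2}. flag_elem \<Psi> j \<noteq> flag_elem \<Phi> j \<longleftrightarrow> j = i))"

definition has_type :: "'a ranked_poset \<Rightarrow> nat \<Rightarrow> nat \<Rightarrow> bool" where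
  "has_type X p q \<longleftrightarrow>
     (\<forall>f\<in>faces X. card {e \<in> edges X. incident X e f} = p) \<and>
     (\<forall>v\<in>vertices X. card {e \<in> edges X. incident X v e} = q)"

definition tight :: "'a ranked_poset \<Rightarrow> nat \<Rightarrow> nat \<Rightarrow> bool" where
  "tight X p q \<longleftrightarrow> has_type X p q \<and> card (flags X) = 2 * p * q"


section \<open>Automorphisms and chirality\<close>

text \<open>Order automorphisms of a polyhedron automatically preserve ranks. The product is composition
  of functions: the product of \<^term>\<open>g\<close> and \<^term>\<open>f\<close> applies \<^term>\<open>f\<close> first.\<close>

definition aut_group :: "'a ranked_poset \<Rightarrow> ('a \<Rightarrow> 'a) monoid" where
  "aut_group X = (BijGroup (elems X))
     \<lparr>carrier := {\<phi> \<in> Bij (elems X). \<forall>x\<in>elems X. \<forall>y\<in>elems X.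
        (\<phi> x, \<phi> y) \<in> ord_rel X \<longleftrightarrow> (x, y) \<in> ord_rel X}\<rparr>"

definition flag_map :: "('a \<Rightarrow> 'a) \<Rightarrow> 'a flag \<Rightarrow> 'a flag" where
  "flag_map \<phi> = map_prod \<phi> (map_prod \<phi> \<phi>)"

definition flag_transitive_on :: "'a ranked_poset \<Rightarrow> 'a flag set \<Rightarrow> bool" where
  "flag_transitive_on X C \<longleftrightarrow>
     (\<forall>\<Phi>\<in>C. \<forall>\<Psi>\<in>C. \<exists>\<phi>\<in>carrier (aut_group X). flag_map \<phi> \<Phi> = \<Psi>)"

definition chiral :: "'a ranked_poset \<Rightarrow> bool" where
  "chiral X \<longleftrightarrow>
     (\<exists>A B. A \<noteq> {} \<and> B \<noteq> {} \<and> A \<inter> B = {} \<and> A \<union> B = flags X \<and>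
        (\<forall>\<Phi>\<in>flags X. \<forall>i\<in>{0, 1, 2}. \<Phi> \<in> A \<longleftrightarrow> adj_flag X i \<Phi> \<in> B) \<and>
        flag_transitive_on X A \<and> flag_transitive_on X B) \<and>
     \<not> flag_transitive_on X (flags X)"

text \<open>The base flag may be any flag. Replacing $\Phi$ by $\Phi^1$ replaces both distinguished
  automorphisms by their inverses, and inversion is an isomorphism onto the opposite group; hence
  the condition below is the same whether automorphisms act on the left (as here) or on the right.\<close>

definition is_aut_group_of ::
    "('g, 'm) monoid_scheme \<Rightarrow> 'g \<Rightarrow> 'g \<Rightarrow> 'a ranked_poset \<Rightarrow> bool" where
  "is_aut_group_of G s1 s2 X \<longleftrightarrow>
     (\<exists>h\<in>iso G (aut_group X). \<exists>\<Phi>\<in>flags X.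
        flag_map (h s1) \<Phi> = adj_flag X 0 (adj_flag X 1 \<Phi>) \<and>
        flag_map (h s2) \<Phi> = adj_flag X 1 (adj_flag X 2 \<Phi>))"

end

theory Submission
  imports Defs
begin

text \<open>In \<open>\<Gamma> = \<Gamma>\<^sup>p\<^sup>,\<^sup>q(3, 1 + c, -3, -1 + c)\<close> the relations give \<open>\<sigma>\<^sub>2 \<sigma>\<^sub>1\<^sup>2 = \<sigma>\<^sub>1\<^sup>2 \<sigma>\<^sub>2\<^sup>1\<^sup>+\<^sup>c\<close>, hence every element has
  the form \<open>\<sigma>\<^sub>1\<^sup>i \<sigma>\<^sub>2\<^sup>j\<close>. An explicit action on pairs of integers modulo \<open>(p, q)\<close> shows that these
  \<open>p q\<close> elements are distinct, so the cosets of \<open>\<langle>\<sigma>\<^sub>2\<rangle>\<close>, \<open>\<langle>\<sigma>\<^sub>2 \<sigma>\<^sub>1\<rangle>\<close> and \<open>\<langle>\<sigma>\<^sub>1\<rangle>\<close> form a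
  tight polyhedron on which \<open>\<Gamma>\<close> acts with two flag orbits. An automorphism joining the orbits would
  allow inverting both generators in the displayed relation, which forces \<open>\<sigma>\<^sub>2\<^sup>2\<^sup>c = 1\<close>; but
  \<open>2 c = \<plusminus> q / 2\<close>.\<close>

section \<open>The coset polyhedron of a tight rotation group\<close>

text \<open>The relation of \<open>s2\<close> with \<open>s1\<close>^2 says that moving
  \<open>s1\<close>^2 to the left past \<open>s2\<close> multiplies the exponent of
  \<open>s2\<close> by 1 + c. Since c*c vanishes modulo q, the power (1 + c)^m is 1 + m*c there,
  also for negative m; the explicit action is built on this linear rule. Moving \<open>s1\<close>^-2
  thus multiplies by 1 - c, whereas an automorphism joining the orbits would force the factor 1 + c.
  The constant c has to meet opposite demands: c*c/2 and c*p/2 must be divisible by q, so that the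
  rule is consistent and depends only on the exponent of \<open>s1\<close> modulo p, but 2*c must
  not be. The choice +-q/4 achieves this under the bounds on \<alpha> and \<beta>. Inverted
  generators appear because each flag orbit is a copy of the group: automorphisms multiply on the
  left, walks through adjacent flags multiply on the right, and a walk that multiplies by a
  generator in one orbit multiplies by its inverse in the other.\<close>

lemma induced_connectedI:
  assumes "z \<in> V" "\<And>x. x \<in> V \<Longrightarrow> (x, z) \<in> {(u, v). u \<in> V \<and> v \<in> V \<and> incident X u v}\<^sup>*"
  shows "induced_connected X V"
proof -
  let ?R = "{(u, v). u \<in> V \<and> v \<in> V \<and> incident X u v}"
  have "sym ?R" by (auto simp: sym_def incident_def)
  then have "(z, x) \<in> ?R\<^sup>*" if "x \<in> V" for x using assms(2)[OF that] by (meson sym_rtrancl symD)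
  then show ?thesis unfolding induced_connected_def using assms by (blast intro: rtrancl_trans)
qed

text \<open>Used to walk around a cycle in both directions when the sections at a vertex or a face
  are shown to be connected.\<close>

lemma int_shift_invariant:
  assumes "\<And>n. P n \<longleftrightarrow> P (n + 1)" "P (0 :: int)" shows "P n"
proof (induction n rule: int_induct[where k=0])
  case (step2 i)
  then show ?case using assms(1)[of "i - 1"] by simp
qed (use assms in auto)

lemma card_pair: "x \<noteq> y \<Longrightarrow> (\<And>z. z \<in> S \<longleftrightarrow> z = x \<or> z = y) \<Longrightarrow> card S = 2"
  by (subgoal_tac "S = {x, y}") auto

lemma card_range_mod:
  assumes "r > 0" "\<And>m n. f m = f n \<longleftrightarrow> int r dvd m - n"
  shows "card (range f) = r"
proof -
  have "bij_betw (f \<circ> int) {..<r} (range f)"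
  proof (rule bij_betw_imageI)
    show "inj_on (f \<circ> int) {..<r}"
      by (rule inj_onI)
        (simp add: assms(2), metis mod_eq_dvd_iff mod_less of_nat_eq_iff zmod_int)
    have *: "f n = f (int (nat (n mod int r)))" for n
      using assms by (simp add: mod_eq_dvd_iff [symmetric])
    show "(f \<circ> int) ` {..<r} = range f"
    proof (intro subset_antisym subsetI)
      fix x assume "x \<in> range f"
      then obtain n where "x = f n" by blast
      then show "x \<in> (f \<circ> int) ` {..<r}" using *[of n] assms(1)
        by (intro image_eqI[where x="nat (n mod int r)"]) (simp_all add: nat_less_iff)
    qed auto
  qed
  then show ?thesis by (metis bij_betw_same_card card_lessThan)
qed

lemma two_element_unique: "\<lbrakk>x = s \<or> x = t; y = s \<or> y = t; z = s \<or> z = t; y \<noteq> x; z \<noteq> x\<rbrakk> \<Longrightarrow> y = z"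
  by auto

text \<open>The axioms \<open>span\<close> and \<open>pow_mult_eq_one\<close> express tightness: G
  is the product of cyclic subgroups of orders p and q with trivial intersection. Chirality enters
  as \<open>no_inverting_map\<close>. It speaks of arbitrary functions because a map on group
  elements read off from a polyhedron automorphism is not known to be a homomorphism.\<close>

locale tight_rotation_group = group G for G (structure) +
  fixes a b and p q :: nat
  assumes a_closed [simp]: "a \<in> carrier G" and b_closed [simp]: "b \<in> carrier G"
    and p_gt_1: "p > 1" and q_gt_1: "q > 1"
    and ab_invol: "a \<otimes> b \<otimes> a \<otimes> b = \<one>"
    and span: "g \<in> carrier G \<Longrightarrow> \<exists>(i :: int) (j :: int). g = a [^] i \<otimes> b [^] j"
    and pow_mult_eq_one: "a [^] (i :: int) \<otimes> b [^] (j :: int) = \<one> \<longleftrightarrow> int p dvd i \<and> int q dvd j"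
    and no_inverting_map: "\<And>\<tau>. \<tau> \<in> carrier G \<rightarrow> carrier G \<Longrightarrow>
      (\<And>g. g \<in> carrier G \<Longrightarrow> \<tau> (g \<otimes> a) = \<tau> g \<otimes> inv a) \<Longrightarrow>
      (\<And>g. g \<in> carrier G \<Longrightarrow> \<tau> (g \<otimes> b) = \<tau> g \<otimes> inv b) \<Longrightarrow> False"
begin

section \<open>Right multiplications and the factorisation of G into powers of a and powers of
  b\<close>

definition ra :: "int \<Rightarrow> 'a \<Rightarrow> 'a" where "ra n g = g \<otimes> a [^] n"
definition rb :: "int \<Rightarrow> 'a \<Rightarrow> 'a" where "rb n g = g \<otimes> b [^] n"
definition rt :: "'a \<Rightarrow> 'a" where "rt g = ra 1 (rb 1 g)"

lemma ra_closed [simp]: "g \<in> carrier G \<Longrightarrow> ra n g \<in> carrier G"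
  and rb_closed [simp]: "g \<in> carrier G \<Longrightarrow> rb n g \<in> carrier G"
  by (simp_all add: ra_def rb_def)

lemma rt_closed [simp]: "g \<in> carrier G \<Longrightarrow> rt g \<in> carrier G"
  by (simp add: rt_def)

lemma ra_ra [simp]: "g \<in> carrier G \<Longrightarrow> ra m (ra n g) = ra (n + m) g"
  and rb_rb [simp]: "g \<in> carrier G \<Longrightarrow> rb m (rb n g) = rb (n + m) g"
  by (simp_all add: ra_def rb_def int_pow_mult m_assoc)

lemma ra_0 [simp]: "g \<in> carrier G \<Longrightarrow> ra 0 g = g"
  and rb_0 [simp]: "g \<in> carrier G \<Longrightarrow> rb 0 g = g"
  by (simp_all add: ra_def rb_def)

text \<open>Left and right multiplications commute. This later makes left multiplication respect
  cosets and adjacency of flags.\<close>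

lemma mult_ra: "k \<in> carrier G \<Longrightarrow> g \<in> carrier G \<Longrightarrow> k \<otimes> ra n g = ra n (k \<otimes> g)"
  and mult_rb: "k \<in> carrier G \<Longrightarrow> g \<in> carrier G \<Longrightarrow> k \<otimes> rb n g = rb n (k \<otimes> g)"
  by (simp_all add: ra_def rb_def m_assoc)

lemma mult_rt: "k \<in> carrier G \<Longrightarrow> g \<in> carrier G \<Longrightarrow> k \<otimes> rt g = rt (k \<otimes> g)"
  by (simp add: rt_def mult_ra mult_rb)

text \<open>The involution relation reads ba = a^-1 b^-1. Hence the second element of an edge
  differs from g by a^-1 up to powers of b, and by b up to powers of a; this identifies its vertex
  and its face.\<close>

lemma rt_alt: "g \<in> carrier G \<Longrightarrow> rt g = rb (-1) (ra (-1) g)"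
proof -
  assume g: "g \<in> carrier G"
  have "a \<otimes> (b \<otimes> (a \<otimes> b)) = \<one>" using ab_invol by (simp add: m_assoc)
  have "b \<otimes> (a \<otimes> b) = inv a"
    using \<open>a \<otimes> (b \<otimes> (a \<otimes> b)) = \<one>\<close> by (metis a_closed b_closed inv_comm inv_equality m_closed)
  then have "b \<otimes> a \<otimes> b = inv a" by (simp add: m_assoc)
  then have "b \<otimes> a = inv a \<otimes> inv b" by (metis a_closed b_closed inv_closed inv_solve_right m_closed)
  then show ?thesis using g by (simp add: rt_def ra_def rb_def int_pow_neg m_assoc)
qed

lemma rt_rt [simp]: "g \<in> carrier G \<Longrightarrow> rt (rt g) = g"
  by (simp add: rt_alt [of g]) (simp add: rt_def)

lemma ra_eq_self [simp]: "g \<in> carrier G \<Longrightarrow> ra n g = g \<longleftrightarrow> int p dvd n"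
  using pow_mult_eq_one[of n 0] by (simp add: ra_def)

lemma rb_eq_self [simp]: "g \<in> carrier G \<Longrightarrow> rb n g = g \<longleftrightarrow> int q dvd n"
  using pow_mult_eq_one[of 0 n] by (simp add: rb_def)

lemma ra_eq_rb_iff:
  assumes "g \<in> carrier G"
  shows "ra m g = rb n g \<longleftrightarrow> int p dvd m \<and> int q dvd n"
proof -
  have "ra m g = rb n g \<longleftrightarrow> a [^] m = b [^] n" using assms by (simp add: ra_def rb_def)
  also have "\<dots> \<longleftrightarrow> a [^] m \<otimes> b [^] (- n) = \<one>"
    by (simp add: int_pow_neg inv_solve_right')
  finally show ?thesis by (simp add: pow_mult_eq_one)
qed

lemma ra_eq_iff:
  assumes "g \<in> carrier G"
  shows "ra m g = ra n g \<longleftrightarrow> int p dvd m - n"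
proof -
  have "ra m g = ra n g \<longleftrightarrow> ra (- n) (ra m g) = ra (-n) (ra n g)"
    using assms by (auto simp: ra_def simp del: ra_ra)
  then show ?thesis using assms by simp
qed

lemma rb_eq_iff:
  assumes "g \<in> carrier G"
  shows "rb m g = rb n g \<longleftrightarrow> int q dvd m - n"
proof -
  have "rb m g = rb n g \<longleftrightarrow> rb (- n) (rb m g) = rb (-n) (rb n g)"
    using assms by (auto simp: rb_def simp del: rb_rb)
  then show ?thesis using assms by simp
qed

text \<open>Every left coset of the powers of a meets every left coset of the powers of b, because
  \<open>inv g \<otimes> h\<close> factors as in \<open>span\<close>.\<close>

lemma ra_rb_meet:
  assumes "g \<in> carrier G" "h \<in> carrier G"
  obtains m n where "ra m g = rb n h"
proof -
  obtain i j :: int where ij: "inv g \<otimes> h = a [^] i \<otimes> b [^] j"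
    using span[OF m_closed[OF inv_closed[OF assms(1)] assms(2)]] by blast
  have "h = g \<otimes> (inv g \<otimes> h)" using assms by (simp add: m_assoc[symmetric])
  then have "h = g \<otimes> (a [^] i \<otimes> b [^] j)" unfolding ij .
  then have "h = rb j (ra i g)" using assms by (simp add: ra_def rb_def m_assoc)
  then have "ra i g = rb (- j) h" using assms by simp
  then show thesis by (rule that)
qed

lemma carrier_repr:
  assumes "g \<in> carrier G"
  obtains i j where "i < p" "j < q" "g = rb (int j) (ra (int i) \<one>)"
proof -
  from span[OF assms] obtain i j :: int where "g = a [^] i \<otimes> b [^] j" by blast
  then have "g = rb j (ra i \<one>)" by (simp add: ra_def rb_def)
  also have "ra i \<one> = ra (int (nat (i mod int p))) \<one>"
    using p_gt_1 by (simp add: ra_eq_iff mod_eq_dvd_iff [symmetric])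
  also have "rb j \<dots> = rb (int (nat (j mod int q))) \<dots>"
    using q_gt_1 by (simp add: rb_eq_iff mod_eq_dvd_iff [symmetric])
  finally show thesis
    by (rule that[rotated 2]) (use p_gt_1 q_gt_1 in \<open>simp_all add: nat_less_iff\<close>)
qed

text \<open>Steps by a and b without their inverses suffice, since the exponents in the
  factorisation can be reduced to natural numbers modulo p and q.\<close>

lemma carrier_induct [consumes 1, case_names one ra rb]:
  assumes g: "g \<in> carrier G" and one: "P \<one>"
    and step: "\<And>g. g \<in> carrier G \<Longrightarrow> P g \<Longrightarrow> P (ra 1 g)" "\<And>g. g \<in> carrier G \<Longrightarrow> P g \<Longrightarrow> P (rb 1 g)"
  shows "P g"
proof -
  have A: "P (ra (int n) \<one>)" for n
  proof (induction n)
    case (Suc n)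
    then have "P (ra 1 (ra (int n) \<one>))" by (rule step(1)[rotated]) simp
    then show ?case by (simp add: add.commute)
  qed (simp add: one)
  have B: "P (rb (int n) (ra (int m) \<one>))" for m n
  proof (induction n)
    case (Suc n)
    then have "P (rb 1 (rb (int n) (ra (int m) \<one>)))" by (rule step(2)[rotated]) simp
    then show ?case by (simp add: add.commute)
  qed (simp add: A)
  from carrier_repr[OF g] B show ?thesis by blast
qed

lemma carrier_bij:
  "bij_betw (\<lambda>(i, j). rb (int j) (ra (int i) \<one>)) ({..<p} \<times> {..<q}) (carrier G)"
proof (rule bij_betw_imageI)
  show "inj_on (\<lambda>(i, j). rb (int j) (ra (int i) \<one>)) ({..<p} \<times> {..<q})"
  proof (clarsimp simp: inj_on_def)
    fix i j k l assume *: "i < p" "j < q" "k < p" "l < q"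
      "rb (int j) (ra (int i) \<one>) = rb (int l) (ra (int k) \<one>)"
    define g where "g = ra (int k) \<one>"
    have g: "g \<in> carrier G" by (simp add: g_def)
    have "rb (- int j) (rb (int j) (ra (int i) \<one>)) = rb (- int j) (rb (int l) (ra (int k) \<one>))"
      by (simp only: *)
    then have "ra (int i - int k) g = rb (int l - int j) g" by (simp add: g_def)
    then have "int p dvd int i - int k" "int q dvd int l - int j"
      using g by (simp_all add: ra_eq_rb_iff)
    then show "i = k \<and> j = l" using *(1-4)
      by (metis mod_eq_dvd_iff mod_pos_pos_trivial of_nat_0_le_iff of_nat_eq_iff of_nat_less_iff)
  qed
  show "(\<lambda>(i, j). rb (int j) (ra (int i) \<one>)) ` ({..<p} \<times> {..<q}) = carrier G"
    by (auto elim!: carrier_repr)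
qed

lemma finite_carrier [simp]: "finite (carrier G)"
  using bij_betw_finite[OF carrier_bij] by simp

lemma card_carrier: "card (carrier G) = p * q"
  using bij_betw_same_card[OF carrier_bij] by simp

text \<open>Vertices, edges and faces are the left cosets of \<open>\<langle>b\<rangle>\<close>, \<open>\<langle>ba\<rangle>\<close> and \<open>\<langle>a\<rangle>\<close>, numbered so
  that the residue modulo 3 is the rank. The edge group is \<open>\<langle>ba\<rangle>\<close> rather than \<open>\<langle>ab\<rangle>\<close> because
  automorphisms act on the left.\<close>

definition code :: "'a set \<Rightarrow> nat" where
  "code = (SOME f. inj_on f (Pow (carrier G)))"

text \<open>Cosets are replaced by natural numbers so that the polyhedron has the element type
  demanded by the theorem; finiteness of G provides the injection.\<close>

lemma inj_code: "inj_on code (Pow (carrier G))"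
proof -
  have "\<exists>f :: 'a set \<Rightarrow> nat. inj_on f (Pow (carrier G))"
    using finite_imp_inj_to_nat_seg[of "Pow (carrier G)"] by auto
  then show ?thesis unfolding code_def by (rule someI_ex)
qed

definition vt :: "'a \<Rightarrow> nat" where "vt g = 3 * code (range (\<lambda>n. rb n g))"
definition ed :: "'a \<Rightarrow> nat" where "ed g = 3 * code {g, rt g} + 1"
definition fc :: "'a \<Rightarrow> nat" where "fc g = 3 * code (range (\<lambda>n. ra n g)) + 2"

lemma rank_mod [simp]: "vt g mod 3 = 0" "ed g mod 3 = 1" "fc g mod 3 = 2"
  unfolding vt_def ed_def fc_def by presburger+

lemma rank_distinct [simp]:
  "vt g \<noteq> ed h" "ed h \<noteq> vt g" "vt g \<noteq> fc h" "fc h \<noteq> vt g" "ed g \<noteq> fc h" "fc h \<noteq> ed g"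
  unfolding vt_def ed_def fc_def by presburger+

lemma code_eq_iff: "A \<subseteq> carrier G \<Longrightarrow> B \<subseteq> carrier G \<Longrightarrow> code A = code B \<longleftrightarrow> A = B"
  using inj_code by (simp add: inj_on_eq_iff)

lemma vt_eq_iff:
  assumes "g \<in> carrier G" "h \<in> carrier G"
  shows "vt g = vt h \<longleftrightarrow> (\<exists>n. h = rb n g)"
proof -
  have "vt g = vt h \<longleftrightarrow> range (\<lambda>n. rb n g) = range (\<lambda>n. rb n h)"
    using assms by (simp add: vt_def code_eq_iff image_subset_iff)
  also have "\<dots> \<longleftrightarrow> (\<exists>n. h = rb n g)"
  proof
    assume "range (\<lambda>n. rb n g) = range (\<lambda>n. rb n h)"
    moreover have "h \<in> range (\<lambda>n. rb n h)" using assms by (intro image_eqI[where x=0]) auto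
    ultimately show "\<exists>n. h = rb n g" by auto
  next
    assume "\<exists>n. h = rb n g"
    then obtain n where "h = rb n g" by blast
    then have "rb m h = rb (n + m) g" "rb m g = rb (m - n) h" for m using assms by auto
    then show "range (\<lambda>n. rb n g) = range (\<lambda>n. rb n h)" by blast
  qed
  finally show ?thesis .
qed

lemma fc_eq_iff:
  assumes "g \<in> carrier G" "h \<in> carrier G"
  shows "fc g = fc h \<longleftrightarrow> (\<exists>n. h = ra n g)"
proof -
  have "fc g = fc h \<longleftrightarrow> range (\<lambda>n. ra n g) = range (\<lambda>n. ra n h)"
    using assms by (simp add: fc_def code_eq_iff image_subset_iff)
  also have "\<dots> \<longleftrightarrow> (\<exists>n. h = ra n g)"
  proof
    assume "range (\<lambda>n. ra n g) = range (\<lambda>n. ra n h)"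
    moreover have "h \<in> range (\<lambda>n. ra n h)" using assms by (intro image_eqI[where x=0]) auto
    ultimately show "\<exists>n. h = ra n g" by auto
  next
    assume "\<exists>n. h = ra n g"
    then obtain n where "h = ra n g" by blast
    then have "ra m h = ra (n + m) g" "ra m g = ra (m - n) h" for m using assms by auto
    then show "range (\<lambda>n. ra n g) = range (\<lambda>n. ra n h)" by blast
  qed
  finally show ?thesis .
qed

lemma ed_eq_iff:
  assumes "g \<in> carrier G" "h \<in> carrier G"
  shows "ed g = ed h \<longleftrightarrow> h = g \<or> h = rt g"
proof -
  have "ed g = ed h \<longleftrightarrow> {g, rt g} = {h, rt h}"
    using assms by (simp add: ed_def code_eq_iff)
  then show ?thesis using assms by auto
qed

lemma vt_rb [simp]: "g \<in> carrier G \<Longrightarrow> vt (rb n g) = vt g"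
  using vt_eq_iff[of g "rb n g"] by auto

lemma fc_ra [simp]: "g \<in> carrier G \<Longrightarrow> fc (ra n g) = fc g"
  using fc_eq_iff[of g "ra n g"] by auto

lemma ed_rt [simp]: "g \<in> carrier G \<Longrightarrow> ed (rt g) = ed g"
  using ed_eq_iff[of g "rt g"] by auto

lemma vt_rt: "g \<in> carrier G \<Longrightarrow> vt (rt g) = vt (ra (-1) g)"
  by (simp add: rt_alt)

lemma fc_rt: "g \<in> carrier G \<Longrightarrow> fc (rt g) = fc (rb 1 g)"
  by (simp add: rt_def)

lemma vt_ra_eq:
  assumes "g \<in> carrier G"
  shows "vt (ra n g) = vt g \<longleftrightarrow> int p dvd n"
proof -
  have "vt g = vt (ra n g) \<longleftrightarrow> (\<exists>m. int p dvd n \<and> int q dvd m)"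
    using assms by (simp add: vt_eq_iff ra_eq_rb_iff)
  then show ?thesis by (metis dvd_0_right)
qed

lemma fc_rb_eq:
  assumes "g \<in> carrier G"
  shows "fc (rb n g) = fc g \<longleftrightarrow> int q dvd n"
proof -
  have "fc g = fc (rb n g) \<longleftrightarrow> (\<exists>m. int p dvd m \<and> int q dvd n)"
    using assms by (simp add: fc_eq_iff ra_eq_rb_iff eq_commute[of "rb n g"])
  then show ?thesis by (metis dvd_0_right)
qed

text \<open>A common power of a and b is trivial. Together with \<open>vt_fc_meet\<close> this makes
  the pairs of a vertex and a face correspond to the elements of G.\<close>

lemma vt_fc_eqD:
  assumes "g \<in> carrier G" "h \<in> carrier G" "vt g = vt h" "fc g = fc h" shows "g = h"
proof -
  obtain m where m: "h = rb m g" using assms by (auto simp: vt_eq_iff)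
  obtain n where n: "h = ra n g" using assms by (auto simp: fc_eq_iff)
  have "ra n g = rb m g" using m n by simp
  then show ?thesis using assms(1) n ra_eq_rb_iff[of g n m] ra_eq_self[of g n] by metis
qed

lemma vt_fc_meet:
  assumes "g \<in> carrier G" "h \<in> carrier G"
  obtains k where "k \<in> carrier G" "vt k = vt g" "fc k = fc h"
proof -
  obtain m n where "ra m h = rb n g" using ra_rb_meet assms by blast
  then show thesis using that[of "rb n g"] assms by (metis fc_ra rb_closed vt_rb)
qed

lemma p_q_neq_1 [simp]: "p \<noteq> Suc 0" "q \<noteq> Suc 0"
  using p_gt_1 q_gt_1 by auto

text \<open>An edge coset consists of x and x times ba, so equality means a^m = b^n or a^(m-1) =
  b^(n+1), and then both sides are trivial. The second alternative, with m = 1 and n = -1, is the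
  source of the second edge between a vertex and a face.\<close>

lemma ed_ra_eq_rb_iff:
  assumes "k \<in> carrier G"
  shows "ed (ra m k) = ed (rb n k) \<longleftrightarrow> (int p dvd m \<and> int q dvd n) \<or> (int p dvd m - 1 \<and> int q dvd n + 1)"
proof -
  have "ra m k = rt (rb n k) \<longleftrightarrow> ra (- 1) (ra m k) = ra (-1) (rt (rb n k))"
    using assms by (auto simp: ra_def simp del: ra_ra)
  also have "\<dots> \<longleftrightarrow> ra (m - 1) k = rb (n + 1) k" using assms by (simp add: rt_def)
  finally show ?thesis using assms
    by (subst eq_commute) (simp add: ed_eq_iff ra_eq_rb_iff)
qed

lemma ed_ra_eq_iff:
  assumes "k \<in> carrier G"
  shows "ed (ra m k) = ed (ra n k) \<longleftrightarrow> int p dvd m - n"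
proof -
  have "ed (ra m k) = ed (ra n k) \<longleftrightarrow> ed (ra (m - n) (ra n k)) = ed (rb 0 (ra n k))"
    using assms by simp
  \<comment> \<open>With exponent 0 on the side of b the second alternative would require q to
    divide 1.\<close>
  also have "\<dots> \<longleftrightarrow> int p dvd m - n" unfolding ed_ra_eq_rb_iff[OF ra_closed[OF assms]] by simp
  finally show ?thesis .
qed

lemma ed_rb_eq_iff:
  assumes "k \<in> carrier G"
  shows "ed (rb m k) = ed (rb n k) \<longleftrightarrow> int q dvd n - m"
proof -
  have "ed (rb m k) = ed (rb n k) \<longleftrightarrow> ed (ra 0 (rb m k)) = ed (rb (n - m) (rb m k))"
    using assms by simp
  also have "\<dots> \<longleftrightarrow> int q dvd n - m" unfolding ed_ra_eq_rb_iff[OF rb_closed[OF assms]] by simp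
  finally show ?thesis .
qed

text \<open>By tightness every vertex is incident with every face.\<close>

definition X :: "nat ranked_poset" where
  "X = \<lparr>elems = vt ` carrier G \<union> ed ` carrier G \<union> fc ` carrier G,
    ord_rel = {(x, x) | x. x \<in> vt ` carrier G \<union> ed ` carrier G \<union> fc ` carrier G}
      \<union> {(vt g, ed g) | g. g \<in> carrier G} \<union> {(ed g, fc g) | g. g \<in> carrier G}
      \<union> vt ` carrier G \<times> fc ` carrier G,
    rank_of = (\<lambda>x. x mod 3)\<rparr>"

lemma elems_X: "elems X = vt ` carrier G \<union> ed ` carrier G \<union> fc ` carrier G"
  by (simp add: X_def)

lemma rank_of_X [simp]: "rank_of X (vt g) = 0" "rank_of X (ed g) = 1" "rank_of X (fc g) = 2"
  by (simp_all add: X_def del: One_nat_def)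

lemma in_elems_X [simp]: "g \<in> carrier G \<Longrightarrow> vt g \<in> elems X" "g \<in> carrier G \<Longrightarrow> ed g \<in> elems X"
   "g \<in> carrier G \<Longrightarrow> fc g \<in> elems X"
  by (simp_all add: elems_X)

lemma vertices_X: "vertices X = vt ` carrier G"
  and edges_X: "rank_set X (Suc 0) = ed ` carrier G"
  and faces_X: "faces X = fc ` carrier G"
  unfolding rank_set_def elems_X by auto

section \<open>Incidence of vertices, edges and faces\<close>

lemma ord_vt_ed:
  assumes "g \<in> carrier G" "h \<in> carrier G"
  shows "(vt g, ed h) \<in> ord_rel X \<longleftrightarrow> (\<exists>n. ed h = ed (rb n g))"
proof -
  have "(vt g, ed h) \<in> ord_rel X \<longleftrightarrow> (\<exists>k\<in>carrier G. vt g = vt k \<and> ed h = ed k)"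
    by (auto simp: X_def)
  also have "\<dots> \<longleftrightarrow> (\<exists>n. ed h = ed (rb n g))"
    using assms by (metis rb_closed vt_eq_iff)
  finally show ?thesis .
qed

lemma ord_ed_fc:
  assumes "g \<in> carrier G" "h \<in> carrier G"
  shows "(ed h, fc g) \<in> ord_rel X \<longleftrightarrow> (\<exists>n. ed h = ed (ra n g))"
proof -
  have "(ed h, fc g) \<in> ord_rel X \<longleftrightarrow> (\<exists>k\<in>carrier G. fc g = fc k \<and> ed h = ed k)"
    by (auto simp: X_def)
  also have "\<dots> \<longleftrightarrow> (\<exists>n. ed h = ed (ra n g))"
    using assms by (metis ra_closed fc_eq_iff)
  finally show ?thesis .
qed

lemma ord_X_simps [simp]:
  assumes "g \<in> carrier G" "h \<in> carrier G"
  shows "(vt g, fc h) \<in> ord_rel X" "(vt g, vt h) \<in> ord_rel X \<longleftrightarrow> vt g = vt h"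
    "(ed g, ed h) \<in> ord_rel X \<longleftrightarrow> ed g = ed h" "(fc g, fc h) \<in> ord_rel X \<longleftrightarrow> fc g = fc h"
    "(ed g, vt h) \<notin> ord_rel X" "(fc g, ed h) \<notin> ord_rel X" "(fc g, vt h) \<notin> ord_rel X"
  using assms by (auto simp: X_def)

lemma incident_X:
  assumes "g \<in> carrier G" "h \<in> carrier G"
  shows "incident X (vt g) (ed h) \<longleftrightarrow> (\<exists>n. ed h = ed (rb n g))"
    "incident X (ed h) (vt g) \<longleftrightarrow> (\<exists>n. ed h = ed (rb n g))"
    "incident X (ed h) (fc g) \<longleftrightarrow> (\<exists>n. ed h = ed (ra n g))"
    "incident X (fc g) (ed h) \<longleftrightarrow> (\<exists>n. ed h = ed (ra n g))"
    "incident X (vt g) (fc h)" "incident X (fc h) (vt g)"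
    "\<not> incident X (vt g) (vt h)" "\<not> incident X (ed g) (ed h)" "\<not> incident X (fc g) (fc h)"
  using assms by (auto simp: incident_def ord_vt_ed ord_ed_fc)

lemma incident_self [simp]:
  assumes "g \<in> carrier G"
  shows "incident X (vt g) (ed g)" "incident X (ed g) (vt g)" "incident X (ed g) (fc g)"
    "incident X (fc g) (ed g)"
  using assms by (simp_all add: incident_X) (metis rb_0 ra_0)+

lemma incident_ed_vt_iff:
  assumes "g \<in> carrier G" "h \<in> carrier G"
  shows "incident X (vt g) (ed h) \<longleftrightarrow> vt g = vt h \<or> vt g = vt (rt h)"
proof
  assume "incident X (vt g) (ed h)"
  then obtain n where "ed h = ed (rb n g)" using assms by (auto simp: incident_X)
  then have "rb n g = h \<or> rb n g = rt h" using assms by (simp add: ed_eq_iff)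
  then show "vt g = vt h \<or> vt g = vt (rt h)" using assms vt_rb by metis
next
  assume "vt g = vt h \<or> vt g = vt (rt h)"
  then show "incident X (vt g) (ed h)" using assms incident_self ed_rt rt_closed by metis
qed

lemma incident_ed_fc_iff:
  assumes "g \<in> carrier G" "h \<in> carrier G"
  shows "incident X (ed h) (fc g) \<longleftrightarrow> fc g = fc h \<or> fc g = fc (rt h)"
proof
  assume "incident X (ed h) (fc g)"
  then obtain n where "ed h = ed (ra n g)" using assms by (auto simp: incident_X)
  then have "ra n g = h \<or> ra n g = rt h" using assms by (simp add: ed_eq_iff)
  then show "fc g = fc h \<or> fc g = fc (rt h)" using assms fc_ra by metis
next
  assume "fc g = fc h \<or> fc g = fc (rt h)"
  then show "incident X (ed h) (fc g)" using assms incident_self ed_rt rt_closed by metis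
qed

text \<open>The diamond condition: an edge reached both by powers of a and by powers of b from k
  must, by \<open>ed_ra_eq_rb_iff\<close>, be reached by a^m with m congruent to 0 or 1 modulo
  p.\<close>

lemma incident_vt_fc_edge_iff:
  assumes "k \<in> carrier G" "h \<in> carrier G"
  shows "incident X (vt k) (ed h) \<and> incident X (ed h) (fc k) \<longleftrightarrow> ed h = ed k \<or> ed h = ed (ra 1 k)"
proof
  assume "incident X (vt k) (ed h) \<and> incident X (ed h) (fc k)"
  then obtain m n where mn: "ed h = ed (ra m k)" "ed h = ed (rb n k)"
    using incident_X(1,3)[OF assms] by blast
  then have "int p dvd m \<or> int p dvd m - 1" using ed_ra_eq_rb_iff assms by metis
  then show "ed h = ed k \<or> ed h = ed (ra 1 k)"
    unfolding mn(1) using assms ed_ra_eq_iff[of k m 0] ed_ra_eq_iff[of k m 1] by auto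
next
  \<comment> \<open>Because b^-1 (ba) = a, the second edge has representatives both in the face
    coset and in the vertex coset of k.\<close>
  have "rt (rb (-1) k) = ra 1 k" using assms by (simp add: rt_def)
  then have "ed (ra 1 k) = ed (rb (-1) k)" using assms by (metis ed_rt rb_closed)
  moreover assume "ed h = ed k \<or> ed h = ed (ra 1 k)"
  ultimately show "incident X (vt k) (ed h) \<and> incident X (ed h) (fc k)"
    using assms by (auto simp: incident_X) (metis ra_0 rb_0)+
qed

lemma ed_neq_ra_1: "k \<in> carrier G \<Longrightarrow> ed k \<noteq> ed (ra 1 k)"
  using ed_ra_eq_iff[of k 0 1] by simp

section \<open>The axioms of a polyhedron, and its type\<close>

lemma partial_order_X: "partial_order_on (elems X) (ord_rel X)"
proof -
  have "trans (ord_rel X)"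
    by (rule transI) (auto simp: X_def)
  moreover have "antisym (ord_rel X)"
    by (rule antisymI) (auto simp: X_def)
  moreover have "refl_on (elems X) (ord_rel X)" "ord_rel X \<subseteq> elems X \<times> elems X"
    by (auto simp: X_def refl_on_def)
  ultimately show ?thesis by (simp add: partial_order_on_def preorder_on_def)
qed

text \<open>All vertices lie on one fixed face, so every other element reaches that face in at most
  two steps.\<close>

lemma connected_X: "induced_connected X (elems X)"
proof (rule induced_connectedI)
  let ?R = "{(u, v). u \<in> elems X \<and> v \<in> elems X \<and> incident X u v}"
  show "fc \<one> \<in> elems X" by simp
  have v: "(vt g, fc \<one>) \<in> ?R" if "g \<in> carrier G" for g
    using that by (simp add: incident_X)
  have e: "(ed g, vt g) \<in> ?R" if "g \<in> carrier G" for g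
    using that by simp
  have f: "(fc g, vt g) \<in> ?R" if "g \<in> carrier G" for g
    using that by (simp add: incident_X)
  fix x assume "x \<in> elems X"
  then obtain g where g: "g \<in> carrier G" and x: "x = vt g \<or> x = ed g \<or> x = fc g"
    by (auto simp: elems_X)
  note v' = r_into_rtrancl[OF v[OF g]]
  show "(x, fc \<one>) \<in> ?R\<^sup>*"
    using x v' converse_rtrancl_into_rtrancl[OF e[OF g] v']
      converse_rtrancl_into_rtrancl[OF f[OF g] v'] by (elim disjE) (simp_all only:)
qed

text \<open>Around \<open>vt k\<close> the edges \<open>ed (rb n k)\<close> and the faces
  \<open>fc (rb n k)\<close> alternate in a cycle; it suffices to join the edges for n and n +
  1.\<close>

lemma connected_vertex:
  assumes k: "k \<in> carrier G"
  shows "induced_connected X (neighbours X (vt k))"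
proof (rule induced_connectedI)
  let ?V = "neighbours X (vt k)"
  let ?R = "{(u, v). u \<in> ?V \<and> v \<in> ?V \<and> incident X u v}"
  show ez: "ed k \<in> ?V" using k by (simp add: neighbours_def)
  have eV: "ed (rb n k) \<in> ?V" and fV: "fc (rb n k) \<in> ?V" for n
    using k by (auto simp: neighbours_def incident_X)
  have 1: "(fc (rb n k), ed (rb n k)) \<in> ?R" "(ed (rb n k), fc (rb n k)) \<in> ?R" for n
    using eV fV k by auto
  \<comment> \<open>Multiplying by ba moves k b^n to k b^(n+1) a, which exhibits the same edge on
    the next face.\<close>
  have "ed (rb n k) = ed (ra 1 (rb (n + 1) k))" for n
    using k ed_rt[of "rb n k"] by (simp add: rt_def)
  then have "incident X (ed (rb n k)) (fc (rb (n + 1) k))" for n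
    using k incident_self(3)[of "ra 1 (rb (n + 1) k)"] by simp
  then have 2: "(fc (rb (n + 1) k), ed (rb n k)) \<in> ?R" "(ed (rb n k), fc (rb (n + 1) k)) \<in> ?R" for n
    using eV fV by (auto simp: incident_def)
  have e: "(ed (rb n k), ed k) \<in> ?R\<^sup>*" for n
  proof (rule int_shift_invariant[where P="\<lambda>n. (ed (rb n k), ed k) \<in> ?R\<^sup>*"])
    fix n
    have s: "(ed (rb n k), ed (rb (n + 1) k)) \<in> ?R\<^sup>*" "(ed (rb (n + 1) k), ed (rb n k)) \<in> ?R\<^sup>*"
      by (rule converse_rtrancl_into_rtrancl[OF 2(2)[of n] r_into_rtrancl[OF 1(1)]],
          rule converse_rtrancl_into_rtrancl[OF 1(2) r_into_rtrancl[OF 2(1)[of n]]])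
    show "(ed (rb n k), ed k) \<in> ?R\<^sup>* \<longleftrightarrow> (ed (rb (n + 1) k), ed k) \<in> ?R\<^sup>*"
      by (rule iffI) (erule rtrancl_trans[OF s(2)], erule rtrancl_trans[OF s(1)])
  qed (use k in simp)
  have f: "(fc (rb n k), ed k) \<in> ?R\<^sup>*" for n
    using 1(1) e by (rule converse_rtrancl_into_rtrancl)
  fix x assume x: "x \<in> ?V"
  then have "x \<in> elems X" by (auto simp: neighbours_def incident_def)
  then obtain h where h: "h \<in> carrier G" "x = vt h \<or> x = ed h \<or> x = fc h" by (auto simp: elems_X)
  then consider "x = ed h" | "x = fc h" using x k by (auto simp: neighbours_def incident_X)
  then show "(x, ed k) \<in> ?R\<^sup>*"
  proof cases
    case 1
    then show ?thesis using x k h e by (auto simp: neighbours_def incident_X)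
  next
    case 2
    \<comment> \<open>Every face is a neighbour of \<open>vt k\<close>; its coset meets that of the
      vertex, hence it occurs in the cycle.\<close>
    obtain l where l: "l \<in> carrier G" "vt l = vt k" "fc l = fc h" by (rule vt_fc_meet[OF k h(1)])
    then obtain n where "l = rb n k" using k vt_eq_iff[of k l] by auto
    then show ?thesis using f[of n] l 2 by simp
  qed
qed

text \<open>Dual to the vertex case, with the cycle of \<open>ed (ra n k)\<close> and
  \<open>vt (ra n k)\<close>.\<close>

lemma connected_face:
  assumes k: "k \<in> carrier G"
  shows "induced_connected X (neighbours X (fc k))"
proof (rule induced_connectedI)
  let ?V = "neighbours X (fc k)"
  let ?R = "{(u, v). u \<in> ?V \<and> v \<in> ?V \<and> incident X u v}"
  show ez: "ed k \<in> ?V" using k by (simp add: neighbours_def)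
  have eV: "ed (ra n k) \<in> ?V" and fV: "vt (ra n k) \<in> ?V" for n
    using k by (auto simp: neighbours_def incident_X)
  have 1: "(vt (ra n k), ed (ra n k)) \<in> ?R" "(ed (ra n k), vt (ra n k)) \<in> ?R" for n
    using eV fV k by auto
  have "ed (ra (n + 1) k) = ed (rb (-1) (ra n k))" for n
    using k ed_rt[of "ra (n + 1) k"] by (simp add: rt_alt)
  then have "incident X (ed (ra (n + 1) k)) (vt (ra n k))" for n
    using k incident_self(2)[of "rb (-1) (ra n k)"] by simp
  then have 2: "(vt (ra n k), ed (ra (n + 1) k)) \<in> ?R" "(ed (ra (n + 1) k), vt (ra n k)) \<in> ?R" for n
    using eV fV by (auto simp: incident_def)
  have e: "(ed (ra n k), ed k) \<in> ?R\<^sup>*" for n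
  proof (rule int_shift_invariant[where P="\<lambda>n. (ed (ra n k), ed k) \<in> ?R\<^sup>*"])
    fix n
    have s: "(ed (ra n k), ed (ra (n + 1) k)) \<in> ?R\<^sup>*" "(ed (ra (n + 1) k), ed (ra n k)) \<in> ?R\<^sup>*"
      by (rule converse_rtrancl_into_rtrancl[OF 1(2) r_into_rtrancl[OF 2(1)[of n]]],
          rule converse_rtrancl_into_rtrancl[OF 2(2)[of n] r_into_rtrancl[OF 1(1)]])
    show "(ed (ra n k), ed k) \<in> ?R\<^sup>* \<longleftrightarrow> (ed (ra (n + 1) k), ed k) \<in> ?R\<^sup>*"
      by (rule iffI) (erule rtrancl_trans[OF s(2)], erule rtrancl_trans[OF s(1)])
  qed (use k in simp)
  have f: "(vt (ra n k), ed k) \<in> ?R\<^sup>*" for n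
    using 1(1) e by (rule converse_rtrancl_into_rtrancl)
  fix x assume x: "x \<in> ?V"
  then have "x \<in> elems X" by (auto simp: neighbours_def incident_def)
  then obtain h where h: "h \<in> carrier G" "x = vt h \<or> x = ed h \<or> x = fc h" by (auto simp: elems_X)
  then consider "x = ed h" | "x = vt h" using x k by (auto simp: neighbours_def incident_X)
  then show "(x, ed k) \<in> ?R\<^sup>*"
  proof cases
    case 1
    then show ?thesis using x k h e by (auto simp: neighbours_def incident_X)
  next
    case 2
    obtain l where l: "l \<in> carrier G" "vt l = vt h" "fc l = fc k" by (rule vt_fc_meet[OF h(1) k])
    then obtain n where "l = ra n k" using k fc_eq_iff[of k l] by auto
    then show ?thesis using f[of n] l 2 by simp
  qed
qed

lemma polyhedron_X: "polyhedron X"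
  unfolding polyhedron_def
proof (intro conjI)
  show "\<forall>x\<in>elems X. rank_of X x \<in> {0, 1, 2}"
    by (auto simp: elems_X simp del: One_nat_def)
  show "\<forall>(x, y)\<in>ord_rel X. x \<noteq> y \<longrightarrow> rank_of X x < rank_of X y"
  proof clarify
    fix x y assume "(x, y) \<in> ord_rel X" "x \<noteq> y"
    then consider g where "x = vt g" "y = ed g" | g where "x = ed g" "y = fc g"
      | g h where "x = vt g" "y = fc h" by (auto simp: X_def)
    then show "rank_of X x < rank_of X y" by cases auto
  qed
  show "\<forall>e\<in>edges X. card {v \<in> vertices X. incident X v e} = 2 \<and> card {f \<in> faces X. incident X e f} = 2"
  proof
    fix e assume "e \<in> edges X"
    then obtain h where h: "h \<in> carrier G" "e = ed h" by (auto simp: edges_X)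
    have "vt h \<noteq> vt (rt h)" using h vt_ra_eq[of h "-1"] by (auto simp: vt_rt)
    then have "card {v \<in> vertices X. incident X v e} = 2"
      by (rule card_pair) (use h in \<open>auto simp: vertices_X incident_ed_vt_iff\<close>)
    moreover have "fc h \<noteq> fc (rt h)" using h fc_rb_eq[of h 1] by (auto simp: fc_rt)
    then have "card {f \<in> faces X. incident X e f} = 2"
      by (rule card_pair) (use h in \<open>auto simp: faces_X incident_ed_fc_iff\<close>)
    ultimately show "card {v \<in> vertices X. incident X v e} = 2 \<and> card {f \<in> faces X. incident X e f} = 2"
      by simp
  qed
  show "\<forall>v\<in>vertices X. \<forall>f\<in>faces X. incident X v f \<longrightarrow>
        card {e \<in> edges X. incident X v e \<and> incident X e f} = 2"
  proof (intro ballI impI)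
    fix v f assume "v \<in> vertices X" "f \<in> faces X"
    then obtain g h where "g \<in> carrier G" "h \<in> carrier G" "v = vt g" "f = fc h"
      by (auto simp: vertices_X faces_X)
    then obtain k where k: "k \<in> carrier G" "v = vt k" "f = fc k" using vt_fc_meet[of g h] by metis
    show "card {e \<in> edges X. incident X v e \<and> incident X e f} = 2"
    proof (rule card_pair)
      show "ed k \<noteq> ed (ra 1 k)" using k ed_neq_ra_1 by simp
      have "incident X (vt k) (ed (ra 1 k))" "incident X (ed (ra 1 k)) (fc k)"
        using k incident_vt_fc_edge_iff[of k "ra 1 k"] by auto
      then show "z \<in> {e \<in> edges X. incident X v e \<and> incident X e f} \<longleftrightarrow>
          z = ed k \<or> z = ed (ra 1 k)" for z
        using k incident_vt_fc_edge_iff[of k] by (auto simp: edges_X)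
    qed
  qed
  show "\<forall>x\<in>vertices X \<union> faces X. induced_connected X (neighbours X x)"
    using connected_vertex connected_face by (auto simp: vertices_X faces_X)
qed (fact partial_order_X connected_X)+

lemma has_type_X: "has_type X p q"
  unfolding has_type_def
proof (intro conjI ballI)
  fix f assume "f \<in> faces X"
  then obtain k where k: "k \<in> carrier G" "f = fc k" by (auto simp: faces_X)
  then have "{e \<in> edges X. incident X e f} = range (\<lambda>n. ed (ra n k))"
    by (auto simp: edges_X incident_X)
  moreover have "card (range (\<lambda>n. ed (ra n k))) = p"
    using k p_gt_1 by (intro card_range_mod) (simp_all add: ed_ra_eq_iff)
  ultimately show "card {e \<in> edges X. incident X e f} = p" by simp
next
  fix v assume "v \<in> vertices X"
  then obtain k where k: "k \<in> carrier G" "v = vt k" by (auto simp: vertices_X)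
  then have "{e \<in> edges X. incident X v e} = range (\<lambda>n. ed (rb n k))"
    by (auto simp: edges_X incident_X)
  moreover have "card (range (\<lambda>n. ed (rb n k))) = q"
    using k q_gt_1 by (intro card_range_mod) (simp_all add: ed_rb_eq_iff dvd_diff_commute)
  ultimately show "card {e \<in> edges X. incident X v e} = q" by simp
qed

text \<open>The two flag orbits; \<open>flagB g\<close> is 1-adjacent to \<open>flagA g\<close>.\<close>

definition flagA :: "'a \<Rightarrow> nat flag" where "flagA g = (vt g, ed g, fc g)"
definition flagB :: "'a \<Rightarrow> nat flag" where "flagB g = (vt g, ed (ra 1 g), fc g)"

text \<open>Vertex and face determine an element k of G, and the diamond condition leaves exactly
  two edges between them.\<close>

lemma flags_X: "flags X = flagA ` carrier G \<union> flagB ` carrier G"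
proof (intro subset_antisym subsetI)
  fix F assume "F \<in> flags X"
  then obtain g h l where F: "g \<in> carrier G" "h \<in> carrier G" "l \<in> carrier G" "F = (vt g, ed h, fc l)"
    "incident X (vt g) (ed h)" "incident X (ed h) (fc l)"
    by (auto simp: flags_def vertices_X edges_X faces_X)
  obtain k where k: "k \<in> carrier G" "vt k = vt g" "fc k = fc l" by (rule vt_fc_meet[OF F(1,3)])
  have "ed h = ed k \<or> ed h = ed (ra 1 k)" using incident_vt_fc_edge_iff[OF k(1) F(2)] F k by simp
  then have "F = flagA k \<or> F = flagB k" using F k by (auto simp: flagA_def flagB_def)
  then show "F \<in> flagA ` carrier G \<union> flagB ` carrier G" using k by blast
next
  fix F assume "F \<in> flagA ` carrier G \<union> flagB ` carrier G"
  then obtain k where k: "k \<in> carrier G" "F = flagA k \<or> F = flagB k" by blast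
  then show "F \<in> flags X"
    using incident_vt_fc_edge_iff[of k k] incident_vt_fc_edge_iff[of k "ra 1 k"]
    by (auto simp: flags_def vertices_X edges_X faces_X flagA_def flagB_def incident_X(5))
qed

lemma flagA_in_flags [simp]: "g \<in> carrier G \<Longrightarrow> flagA g \<in> flags X"
  and flagB_in_flags [simp]: "g \<in> carrier G \<Longrightarrow> flagB g \<in> flags X"
  by (simp_all add: flags_X)

lemma flagA_eq_iff: "g \<in> carrier G \<Longrightarrow> h \<in> carrier G \<Longrightarrow> flagA g = flagA h \<longleftrightarrow> g = h"
  and flagB_eq_iff: "g \<in> carrier G \<Longrightarrow> h \<in> carrier G \<Longrightarrow> flagB g = flagB h \<longleftrightarrow> g = h"
  by (auto simp: flagA_def flagB_def dest: vt_fc_eqD)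

lemma flagA_neq_flagB:
  assumes "g \<in> carrier G" "h \<in> carrier G" shows "flagA g \<noteq> flagB h"
proof
  assume *: "flagA g = flagB h"
  then have "g = h" using assms by (auto simp: flagA_def flagB_def dest: vt_fc_eqD)
  then show False using * assms ed_neq_ra_1[of h] by (simp add: flagA_def flagB_def)
qed

lemma card_flags_X: "card (flags X) = 2 * p * q"
proof -
  have "card (flagA ` carrier G) = p * q" "card (flagB ` carrier G) = p * q"
    by (simp_all add: card_image inj_on_def flagA_eq_iff flagB_eq_iff card_carrier)
  moreover have "flagA ` carrier G \<inter> flagB ` carrier G = {}" using flagA_neq_flagB by blast
  ultimately show ?thesis by (simp add: flags_X card_Un_disjoint)
qed

lemma tight_X: "tight X p q"
  using has_type_X card_flags_X by (simp add: tight_def)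

section \<open>Adjacent flags\<close>

definition adjacent :: "nat \<Rightarrow> nat flag \<Rightarrow> nat flag \<Rightarrow> bool" where
  "adjacent i \<Phi> \<Psi> \<longleftrightarrow> (\<forall>j\<in>{0, 1, 2}. flag_elem \<Psi> j \<noteq> flag_elem \<Phi> j \<longleftrightarrow> j = i)"

lemma adjacent_simps:
  "adjacent 0 (v, e, f) (v', e', f') \<longleftrightarrow> v' \<noteq> v \<and> e' = e \<and> f' = f"
  "adjacent (Suc 0) (v, e, f) (v', e', f') \<longleftrightarrow> v' = v \<and> e' \<noteq> e \<and> f' = f"
  "adjacent 2 (v, e, f) (v', e', f') \<longleftrightarrow> v' = v \<and> e' = e \<and> f' \<noteq> f"
  by (auto simp: adjacent_def)

lemma adjacent_unique:
  assumes "\<Phi> \<in> flags X" "\<Psi> \<in> flags X" "\<Psi>' \<in> flags X" "i \<in> {0, 1, 2}"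
    "adjacent i \<Phi> \<Psi>" "adjacent i \<Phi> \<Psi>'"
  shows "\<Psi> = \<Psi>'"
proof -
  obtain v e f where \<Phi>: "\<Phi> = (v, e, f)" by (cases \<Phi>)
  obtain v1 e1 f1 where \<Psi>: "\<Psi> = (v1, e1, f1)" by (cases \<Psi>)
  obtain v2 e2 f2 where \<Psi>': "\<Psi>' = (v2, e2, f2)" by (cases \<Psi>')
  note inc = assms(1-3)[unfolded \<Phi> \<Psi> \<Psi>' flags_def mem_Collect_eq prod.case]
  obtain h where h: "h \<in> carrier G" "e = ed h" using inc by (auto simp: edges_X)
  consider "i = 0" | "i = Suc 0" | "i = 2" using assms(4) by auto
  then show ?thesis
  proof cases
    case 1
    then have *: "v1 \<noteq> v" "e1 = e" "f1 = f" "v2 \<noteq> v" "e2 = e" "f2 = f"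
      using assms(5,6) by (auto simp: \<Phi> \<Psi> \<Psi>' adjacent_simps)
    have "w = vt h \<or> w = vt (rt h)" if "w \<in> vertices X" "incident X w e" for w
      using that h by (auto simp: vertices_X incident_ed_vt_iff)
    then have "v1 = v2" using inc * by (intro two_element_unique[of v _ _ v1 v2]) blast+
    then show ?thesis using * by (simp add: \<Psi> \<Psi>')
  next
    case 2
    then have *: "v1 = v" "e1 \<noteq> e" "f1 = f" "v2 = v" "e2 \<noteq> e" "f2 = f"
      using assms(5,6) by (auto simp: \<Phi> \<Psi> \<Psi>' adjacent_simps)
    obtain k where k: "k \<in> carrier G" "v = vt k" "f = fc k"
      using assms(1) by (auto simp: flags_X \<Phi> flagA_def flagB_def)
    have "w = ed k \<or> w = ed (ra 1 k)" if "w \<in> edges X" "incident X v w" "incident X w f" for w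
      using that k incident_vt_fc_edge_iff[OF k(1)] by (auto simp: edges_X)
    then have "e1 = e2" using inc * by (intro two_element_unique[of e _ _ e1 e2]) blast+
    then show ?thesis using * by (simp add: \<Psi> \<Psi>')
  next
    case 3
    then have *: "v1 = v" "e1 = e" "f1 \<noteq> f" "v2 = v" "e2 = e" "f2 \<noteq> f"
      using assms(5,6) by (auto simp: \<Phi> \<Psi> \<Psi>' adjacent_simps)
    have "w = fc h \<or> w = fc (rt h)" if "w \<in> faces X" "incident X e w" for w
      using that h by (auto simp: faces_X incident_ed_fc_iff)
    then have "f1 = f2" using inc * by (intro two_element_unique[of f _ _ f1 f2]) blast+
    then show ?thesis using * by (simp add: \<Psi> \<Psi>')
  qed
qed

lemma adj_flag_eqI:
  assumes "\<Phi> \<in> flags X" "\<Psi> \<in> flags X" "i \<in> {0, 1, 2}" "adjacent i \<Phi> \<Psi>"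
  shows "adj_flag X i \<Phi> = \<Psi>"
  unfolding adj_flag_def adjacent_def[symmetric]
  using assms adjacent_unique by (intro the_equality) blast+

text \<open>Adjacency swaps the two families and multiplies on the right. Consequently the
  1-adjacent flag followed by its 0-adjacent one leads from \<open>flagA g\<close> to
  \<open>flagA (ra 1 g)\<close>, and 2 followed by 1 leads to \<open>flagA (rb 1 g)\<close>; these
  are the walks of the distinguished generators. Starting from \<open>flagB g\<close> the same walks
  multiply by the inverses.\<close>

lemma adjacent_flags:
  assumes k: "k \<in> carrier G"
  shows "adjacent 0 (flagA k) (flagB (ra (-1) k))" "adjacent (Suc 0) (flagA k) (flagB k)"
    "adjacent 2 (flagA k) (flagB (rb 1 k))"
    "adjacent 0 (flagB k) (flagA (ra 1 k))" "adjacent (Suc 0) (flagB k) (flagA k)"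
    "adjacent 2 (flagB k) (flagA (rb (-1) k))"
proof -
  have e: "ed (ra 1 k) = ed (rb (-1) k)"
    using k ed_rt[of "rb (-1) k"] by (simp add: rt_def)
  have e': "ed (ra 1 (rb 1 k)) = ed k" using k ed_rt[of k] by (simp add: rt_def)
  have "vt (ra (-1) k) \<noteq> vt k" "vt (ra 1 k) \<noteq> vt k" "fc (rb (-1) k) \<noteq> fc k" "fc (rb 1 k) \<noteq> fc k"
    using k by (simp_all add: vt_ra_eq fc_rb_eq)
  then show "adjacent 0 (flagA k) (flagB (ra (-1) k))" "adjacent (Suc 0) (flagA k) (flagB k)"
    "adjacent 2 (flagA k) (flagB (rb 1 k))"
    "adjacent 0 (flagB k) (flagA (ra 1 k))" "adjacent (Suc 0) (flagB k) (flagA k)"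
    "adjacent 2 (flagB k) (flagA (rb (-1) k))"
    using k ed_neq_ra_1[OF k] e e' by (auto simp: flagA_def flagB_def adjacent_simps)
qed

lemma adj_flag_X:
  assumes k: "k \<in> carrier G"
  shows "adj_flag X 0 (flagA k) = flagB (ra (-1) k)" "adj_flag X (Suc 0) (flagA k) = flagB k"
    "adj_flag X 2 (flagA k) = flagB (rb 1 k)"
    "adj_flag X 0 (flagB k) = flagA (ra 1 k)" "adj_flag X (Suc 0) (flagB k) = flagA k"
    "adj_flag X 2 (flagB k) = flagA (rb (-1) k)"
  using adjacent_flags[OF k] k by (simp_all add: adj_flag_eqI)

lemma adj_flag_adjacent:
  assumes "\<Phi> \<in> flags X" "i \<in> {0, 1, 2}"
  shows "adj_flag X i \<Phi> \<in> flags X" "adjacent i \<Phi> (adj_flag X i \<Phi>)"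
  using assms by (auto simp: flags_X adj_flag_X adjacent_flags)

definition act :: "'a \<Rightarrow> nat \<Rightarrow> nat" where
  "act k = (\<lambda>x\<in>elems X. if x mod 3 = 0 then vt (k \<otimes> inv_into (carrier G) vt x)
     else if x mod 3 = 1 then ed (k \<otimes> inv_into (carrier G) ed x)
     else fc (k \<otimes> inv_into (carrier G) fc x))"

text \<open>The representative picked by \<open>inv_into\<close> is arbitrary; the result is
  independent of it because left multiplication commutes with \<open>rb\<close>, \<open>rt\<close>
  and \<open>ra\<close>.\<close>

lemma act_simps:
  assumes k: "k \<in> carrier G" and g: "g \<in> carrier G"
  shows "act k (vt g) = vt (k \<otimes> g)" "act k (ed g) = ed (k \<otimes> g)" "act k (fc g) = fc (k \<otimes> g)"
proof -
  have inv: "inv_into (carrier G) c (c g) \<in> carrier G" "c (inv_into (carrier G) c (c g)) = c g"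
    for c :: "'a \<Rightarrow> nat" using g by (simp_all add: inv_into_into f_inv_into_f)
  have v: "vt (k \<otimes> h) = vt (k \<otimes> g)" if "h \<in> carrier G" "vt h = vt g" for h
    using that k g by (auto simp: vt_eq_iff[of h g] mult_rb)
  have e: "ed (k \<otimes> h) = ed (k \<otimes> g)" if "h \<in> carrier G" "ed h = ed g" for h
    using that k g by (auto simp: ed_eq_iff[of h g] mult_rt)
  have f: "fc (k \<otimes> h) = fc (k \<otimes> g)" if "h \<in> carrier G" "fc h = fc g" for h
    using that k g by (auto simp: fc_eq_iff[of h g] mult_ra)
  show "act k (vt g) = vt (k \<otimes> g)"
    using g v[OF inv] by (simp add: act_def)
  show "act k (ed g) = ed (k \<otimes> g)"
    using g e[OF inv] by (simp add: act_def del: One_nat_def)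
  show "act k (fc g) = fc (k \<otimes> g)"
    using g f[OF inv] by (simp add: act_def)
qed

lemma elems_X_cases:
  assumes "x \<in> elems X"
  obtains g where "g \<in> carrier G" "x = vt g" | g where "g \<in> carrier G" "x = ed g"
    | g where "g \<in> carrier G" "x = fc g"
  using assms by (auto simp: elems_X)

lemma act_closed: "k \<in> carrier G \<Longrightarrow> x \<in> elems X \<Longrightarrow> act k x \<in> elems X"
  by (erule elems_X_cases) (simp_all add: act_simps)

lemma act_act:
  "k \<in> carrier G \<Longrightarrow> l \<in> carrier G \<Longrightarrow> x \<in> elems X \<Longrightarrow> act k (act l x) = act (k \<otimes> l) x"
  by (erule elems_X_cases) (simp_all add: act_simps m_assoc)

lemma act_one: "x \<in> elems X \<Longrightarrow> act \<one> x = x"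
  by (erule elems_X_cases) (simp_all add: act_simps)

lemma act_ord:
  assumes "k \<in> carrier G" "(x, y) \<in> ord_rel X"
  shows "(act k x, act k y) \<in> ord_rel X"
proof -
  consider "x = y" "x \<in> elems X" | g where "g \<in> carrier G" "x = vt g" "y = ed g"
    | g where "g \<in> carrier G" "x = ed g" "y = fc g"
    | g h where "g \<in> carrier G" "h \<in> carrier G" "x = vt g" "y = fc h"
    using assms(2) by (auto simp: X_def)
  then show ?thesis
  proof cases
    case 1
    then show ?thesis using act_closed[OF assms(1) 1(2)] partial_order_X
      by (simp add: partial_order_on_def preorder_on_def refl_on_def)
  next
    case 2
    then have "(vt (k \<otimes> g), ed (k \<otimes> g)) \<in> ord_rel X"
      using assms(1) by (auto simp: X_def)
    then show ?thesis using 2 assms(1) by (simp add: act_simps)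
  next
    case 3
    then have "(ed (k \<otimes> g), fc (k \<otimes> g)) \<in> ord_rel X"
      using assms(1) by (auto simp: X_def)
    then show ?thesis using 3 assms(1) by (simp add: act_simps)
  next
    case 4
    then show ?thesis using assms(1) by (simp add: act_simps)
  qed
qed

lemma carrier_aut_group:
  "\<phi> \<in> carrier (aut_group X) \<longleftrightarrow> \<phi> \<in> Bij (elems X) \<and>
     (\<forall>x\<in>elems X. \<forall>y\<in>elems X. (\<phi> x, \<phi> y) \<in> ord_rel X \<longleftrightarrow> (x, y) \<in> ord_rel X)"
  by (simp add: aut_group_def)

lemma act_inv_act:
  assumes "k \<in> carrier G" "x \<in> elems X"
  shows "act (inv k) (act k x) = x" "act k (act (inv k) x) = x"
  using assms by (simp_all add: act_act act_one)

lemma act_aut: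
  assumes k: "k \<in> carrier G"
  shows "act k \<in> carrier (aut_group X)"
proof -
  have "bij_betw (act k) (elems X) (elems X)"
    by (rule bij_betw_byWitness[where f'="act (inv k)"])
      (use k in \<open>auto simp: act_inv_act act_closed\<close>)
  moreover have "act k \<in> extensional (elems X)" by (simp add: act_def)
  moreover have "(act k x, act k y) \<in> ord_rel X \<longleftrightarrow> (x, y) \<in> ord_rel X"
    if "x \<in> elems X" "y \<in> elems X" for x y
    using act_ord[OF k, of x y] act_ord[of "inv k" "act k x" "act k y"] k that
    by (auto simp: act_inv_act)
  ultimately show ?thesis by (simp add: carrier_aut_group Bij_def)
qed

lemma act_mult:
  assumes "k \<in> carrier G" "l \<in> carrier G"
  shows "act (k \<otimes> l) = act k \<otimes>\<^bsub>aut_group X\<^esub> act l"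
proof -
  have "act k \<in> Bij (elems X)" "act l \<in> Bij (elems X)"
    using act_aut assms carrier_aut_group by blast+
  then have "act k \<otimes>\<^bsub>aut_group X\<^esub> act l = compose (elems X) (act k) (act l)"
    by (simp add: aut_group_def BijGroup_def)
  also have "\<dots> = act (k \<otimes> l)"
  proof
    fix x show "compose (elems X) (act k) (act l) x = act (k \<otimes> l) x"
      by (cases "x \<in> elems X") (simp_all add: compose_def act_act assms, simp add: act_def)
  qed
  finally show ?thesis by simp
qed

lemma flag_map_act:
  assumes "k \<in> carrier G" "g \<in> carrier G"
  shows "flag_map (act k) (flagA g) = flagA (k \<otimes> g)" "flag_map (act k) (flagB g) = flagB (k \<otimes> g)"
  using assms by (simp_all add: flag_map_def flagA_def flagB_def act_simps mult_ra)

section \<open>Automorphisms are left multiplications\<close>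

context
  fixes \<phi> assumes aut: "\<phi> \<in> carrier (aut_group X)"
begin

lemma aut_closed: "x \<in> elems X \<Longrightarrow> \<phi> x \<in> elems X"
  using aut unfolding carrier_aut_group by (auto simp: Bij_def bij_betw_def)

lemma aut_eq_iff: "x \<in> elems X \<Longrightarrow> y \<in> elems X \<Longrightarrow> \<phi> x = \<phi> y \<longleftrightarrow> x = y"
  using aut unfolding carrier_aut_group by (auto simp: Bij_def bij_betw_def inj_on_eq_iff)

lemma aut_incident: "x \<in> elems X \<Longrightarrow> y \<in> elems X \<Longrightarrow> incident X (\<phi> x) (\<phi> y) \<longleftrightarrow> incident X x y"
  using aut unfolding carrier_aut_group incident_def by (auto simp: aut_closed aut_eq_iff)

lemma aut_rank_less:
  assumes "x \<in> elems X" "y \<in> elems X" "(x, y) \<in> ord_rel X" "x \<noteq> y"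
  shows "rank_of X (\<phi> x) < rank_of X (\<phi> y)"
proof -
  have "(\<phi> x, \<phi> y) \<in> ord_rel X" "\<phi> x \<noteq> \<phi> y"
    using aut assms by (auto simp: carrier_aut_group aut_eq_iff)
  then show ?thesis using polyhedron_X by (auto simp: polyhedron_def)
qed

text \<open>Automorphisms are only required to preserve the order. A chain of a vertex, an edge and
  a face is sent to a chain with strictly increasing ranks below 3, which must be 0, 1, 2.\<close>

lemma aut_rank:
  assumes "x \<in> elems X"
  shows "rank_of X (\<phi> x) = rank_of X x"
proof -
  obtain g where g: "g \<in> carrier G" "x = vt g \<or> x = ed g \<or> x = fc g"
    using assms by (auto simp: elems_X)
  have "(vt g, ed g) \<in> ord_rel X" "(ed g, fc g) \<in> ord_rel X" using g(1) by (auto simp: X_def)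
  then have "rank_of X (\<phi> (vt g)) < rank_of X (\<phi> (ed g))" "rank_of X (\<phi> (ed g)) < rank_of X (\<phi> (fc g))"
    using g(1) by (simp_all add: aut_rank_less)
  moreover have "rank_of X (\<phi> (fc g)) < 3" by (simp add: X_def)
  ultimately show ?thesis using g(2) by auto
qed

lemma aut_flags:
  assumes "\<Phi> \<in> flags X"
  shows "flag_map \<phi> \<Phi> \<in> flags X"
  using assms by (auto simp: flags_def flag_map_def rank_set_def aut_rank aut_closed aut_incident)

lemma aut_adj_flag:
  assumes "\<Phi> \<in> flags X" "i \<in> {0, 1, 2}"
  shows "flag_map \<phi> (adj_flag X i \<Phi>) = adj_flag X i (flag_map \<phi> \<Phi>)"
proof (rule adj_flag_eqI[symmetric])
  obtain v e f where \<Phi>: "\<Phi> = (v, e, f)" by (cases \<Phi>)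
  obtain v' e' f' where \<Psi>: "adj_flag X i \<Phi> = (v', e', f')" by (cases "adj_flag X i \<Phi>")
  note adj = adj_flag_adjacent[OF assms, unfolded \<Psi>]
  show "flag_map \<phi> (adj_flag X i \<Phi>) \<in> flags X" using adj(1) by (simp only: \<Psi> aut_flags)
  have "{v, e, f, v', e', f'} \<subseteq> elems X"
    using assms(1)[unfolded \<Phi>] adj(1) by (simp add: flags_def rank_set_def)
  then show "adjacent i (flag_map \<phi> \<Phi>) (flag_map \<phi> (adj_flag X i \<Phi>))"
    using adj(2) assms(2) unfolding \<Psi> unfolding \<Phi>
    by (auto simp: flag_map_def adjacent_simps aut_eq_iff)
qed (use assms aut_flags in auto)

text \<open>Automorphisms commute with passing to adjacent flags, so the image of the base flag
  propagates along walks, each generator being a composite of two adjacencies.\<close>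

lemma aut_flagA:
  assumes k: "k \<in> carrier G" "flag_map \<phi> (flagA \<one>) = flagA k" and g: "g \<in> carrier G"
  shows "flag_map \<phi> (flagA g) = flagA (k \<otimes> g)"
  using g
proof (induction g rule: carrier_induct)
  case (ra g)
  have "flagA (ra 1 g) = adj_flag X 0 (adj_flag X 1 (flagA g))" using ra by (simp add: adj_flag_X)
  then have "flag_map \<phi> (flagA (ra 1 g)) = adj_flag X 0 (adj_flag X 1 (flag_map \<phi> (flagA g)))"
    using ra by (simp add: aut_adj_flag adj_flag_adjacent)
  then show ?case using ra k by (simp add: adj_flag_X mult_ra)
next
  case (rb g)
  have "flagA (rb 1 g) = adj_flag X 1 (adj_flag X 2 (flagA g))" using rb by (simp add: adj_flag_X)
  then have "flag_map \<phi> (flagA (rb 1 g)) = adj_flag X 1 (adj_flag X 2 (flag_map \<phi> (flagA g)))"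
    using rb by (simp add: aut_adj_flag adj_flag_adjacent)
  then show ?case using rb k by (simp add: adj_flag_X mult_rb)
qed (use k in simp_all)

text \<open>Following walks from the base flag, an automorphism that switches the families would
  turn each right multiplication by a generator into one by its inverse, contrary to
  \<open>no_inverting_map\<close>.\<close>

lemma aut_base_neq_flagB:
  assumes k: "k \<in> carrier G"
  shows "flag_map \<phi> (flagA \<one>) \<noteq> flagB k"
proof
  assume base: "flag_map \<phi> (flagA \<one>) = flagB k"
  have step: "flag_map \<phi> (flagA (ra 1 g)) = flagB (ra (-1) h) \<and> flag_map \<phi> (flagA (rb 1 g)) = flagB (rb (-1) h)"
    if "g \<in> carrier G" "h \<in> carrier G" "flag_map \<phi> (flagA g) = flagB h" for g h
  proof -
    have "flagA (ra 1 g) = adj_flag X 0 (adj_flag X 1 (flagA g))"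
      "flagA (rb 1 g) = adj_flag X 1 (adj_flag X 2 (flagA g))" using that by (simp_all add: adj_flag_X)
    then have "flag_map \<phi> (flagA (ra 1 g)) = adj_flag X 0 (adj_flag X 1 (flagB h))"
       "flag_map \<phi> (flagA (rb 1 g)) = adj_flag X 1 (adj_flag X 2 (flagB h))"
      using that by (simp_all add: aut_adj_flag adj_flag_adjacent)
    then show ?thesis using that by (simp add: adj_flag_X)
  qed
  have ex: "\<exists>h\<in>carrier G. flag_map \<phi> (flagA g) = flagB h" if "g \<in> carrier G" for g
    using that
  proof (induction g rule: carrier_induct)
    case one then show ?case using base k by blast
  next
    case (ra g) then show ?case using step by (meson ra_closed)
  next
    case (rb g) then show ?case using step by (meson rb_closed)
  qed
  then obtain \<tau> where \<tau>: "\<And>g. g \<in> carrier G \<Longrightarrow> \<tau> g \<in> carrier G \<and> flag_map \<phi> (flagA g) = flagB (\<tau> g)"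
    by metis
  have "\<tau> (ra 1 g) = ra (-1) (\<tau> g)" "\<tau> (rb 1 g) = rb (-1) (\<tau> g)" if "g \<in> carrier G" for g
    using \<tau>[of g] \<tau>[of "ra 1 g"] \<tau>[of "rb 1 g"] that step[of g "\<tau> g"]
    by (auto simp: flagB_eq_iff)
  then show False using \<tau>
    by (intro no_inverting_map[of \<tau>]) (auto simp: ra_def rb_def int_pow_neg)
qed

text \<open>The base flag must stay in its family, say at \<open>flagA k\<close>; then
  \<open>aut_flagA\<close> fixes the image of every flag of that family, and these flags cover all
  elements.\<close>

lemma aut_eq_act: "\<exists>k\<in>carrier G. \<phi> = act k"
proof -
  have "flag_map \<phi> (flagA \<one>) \<in> flags X" by (simp add: aut_flags)
  then obtain k where k: "k \<in> carrier G" "flag_map \<phi> (flagA \<one>) = flagA k"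
    using aut_base_neq_flagB by (auto simp: flags_X)
  have "\<phi> x = act k x" for x
  proof (cases "x \<in> elems X")
    case True
    then obtain g where "g \<in> carrier G" "x = vt g \<or> x = ed g \<or> x = fc g" by (auto simp: elems_X)
    then show ?thesis using aut_flagA[OF k, of g] k(1)
      by (auto simp: flag_map_def flagA_def act_simps)
  next
    case False
    moreover have "\<phi> \<in> extensional (elems X)" using aut by (simp add: carrier_aut_group Bij_def)
    ultimately show ?thesis by (simp add: extensional_def act_def)
  qed
  then show ?thesis using k(1) by blast
qed

end

section \<open>Chirality and the identification of the automorphism group\<close>

lemma chiral_X: "chiral X"
  unfolding chiral_def
proof (intro conjI exI)
  show "flagA ` carrier G \<noteq> {}" "flagB ` carrier G \<noteq> {}" by auto
  show disj: "flagA ` carrier G \<inter> flagB ` carrier G = {}" using flagA_neq_flagB by blast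
  show "flagA ` carrier G \<union> flagB ` carrier G = flags X" by (simp add: flags_X)
  show "\<forall>\<Phi>\<in>flags X. \<forall>i\<in>{0, 1, 2}. \<Phi> \<in> flagA ` carrier G \<longleftrightarrow> adj_flag X i \<Phi> \<in> flagB ` carrier G"
  proof (intro ballI)
    fix \<Phi> i assume *: "\<Phi> \<in> flags X" "i \<in> {0, 1, 2 :: nat}"
    then consider g where "g \<in> carrier G" "\<Phi> = flagA g" | g where "g \<in> carrier G" "\<Phi> = flagB g"
      by (auto simp: flags_X)
    then show "\<Phi> \<in> flagA ` carrier G \<longleftrightarrow> adj_flag X i \<Phi> \<in> flagB ` carrier G"
    proof cases
      case 1
      then show ?thesis using * by (auto simp: adj_flag_X)
    next
      case 2
      then have "\<Phi> \<notin> flagA ` carrier G" using disj by blast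
      moreover have "adj_flag X i \<Phi> \<in> flagA ` carrier G" using 2 * by (auto simp: adj_flag_X)
      ultimately show ?thesis using disj by blast
    qed
  qed
  have tr: "\<exists>\<phi>\<in>carrier (aut_group X). flag_map \<phi> (flagA g) = flagA h \<and> flag_map \<phi> (flagB g) = flagB h"
    if "g \<in> carrier G" "h \<in> carrier G" for g h
    using that act_aut[of "h \<otimes> inv g"]
    by (intro bexI[of _ "act (h \<otimes> inv g)"]) (simp_all add: flag_map_act m_assoc)
  show "flag_transitive_on X (flagA ` carrier G)"
    unfolding flag_transitive_on_def by (intro ballI, elim imageE, drule (1) tr[rotated]) blast
  show "flag_transitive_on X (flagB ` carrier G)"
    unfolding flag_transitive_on_def by (intro ballI, elim imageE, drule (1) tr[rotated]) blast
  show "\<not> flag_transitive_on X (flags X)"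
    unfolding flag_transitive_on_def using aut_base_neq_flagB[OF _ one_closed]
      flagA_in_flags[OF one_closed] flagB_in_flags[OF one_closed] by blast
qed

lemma act_iso: "act \<in> iso G (aut_group X)"
proof (rule isoI)
  show "act \<in> hom G (aut_group X)" by (rule homI) (simp_all add: act_aut act_mult)
  have "inj_on act (carrier G)"
  proof (rule inj_onI)
    fix k l assume kl: "k \<in> carrier G" "l \<in> carrier G" "act k = act l"
    have "flagA (k \<otimes> \<one>) = flagA (l \<otimes> \<one>)"
      unfolding flag_map_act(1)[OF kl(1) one_closed, symmetric] kl(3)
      by (rule flag_map_act(1)[OF kl(2) one_closed])
    then show "k = l" using kl by (simp add: flagA_eq_iff)
  qed
  moreover have "act ` carrier G = carrier (aut_group X)"
    using act_aut aut_eq_act by (intro subset_antisym subsetI) auto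
  ultimately show "bij_betw act (carrier G) (carrier (aut_group X))" by (simp add: bij_betw_def)
qed

theorem is_aut_group_of_X: "is_aut_group_of G a b X"
  unfolding is_aut_group_of_def
proof (intro bexI conjI)
  have "ra 1 \<one> = a" "rb 1 \<one> = b" by (simp_all add: ra_def rb_def)
  then show "flag_map (act a) (flagA \<one>) = adj_flag X 0 (adj_flag X 1 (flagA \<one>))"
    "flag_map (act b) (flagA \<one>) = adj_flag X 1 (adj_flag X 2 (flagA \<one>))"
    by (simp_all add: flag_map_act adj_flag_X)
qed (simp_all add: act_iso)

end

section \<open>An action of the presented group\<close>

text \<open>Left multiplication by \<open>\<sigma>\<^sub>1\<^sup>n\<close> and \<open>\<sigma>\<^sub>2\<^sup>n\<close> on the
  exponents \<open>(i, j)\<close> of \<open>\<sigma>\<^sub>1\<^sup>i \<sigma>\<^sub>2\<^sup>j\<close>. On integer pairs both are genuine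
  actions of the integers; the relators act trivially only modulo \<open>(p, q)\<close>.\<close>

definition shift :: "int \<Rightarrow> int \<times> int \<Rightarrow> int \<times> int" where
  "shift n = (\<lambda>(i, j). (i + n, j))"

text \<open>For i = 2m the power (1 + c)^m is replaced by 1 + m*c. For i = 2m + 1 one step uses
  \<open>s2\<close> \<open>s1\<close> = \<open>s1\<close>^-1 \<open>s2\<close>^-1: it lowers m by 1
  and subtracts 1 + m*c from j. Summing 1 + (m - k)*c over k < n gives the closed form with the
  triangular number n(n-1)/2, which also serves negative n.\<close>

definition twist :: "int \<Rightarrow> int \<Rightarrow> int \<times> int \<Rightarrow> int \<times> int" where
  "twist c n = (\<lambda>(i, j). if even i then (i, j + n * (1 + i div 2 * c))
     else (i - 2 * n, j - n - c * (n * (i div 2) - n * (n - 1) div 2)))"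

fun letter_act :: "int \<Rightarrow> gen \<times> bool \<Rightarrow> int \<times> int \<Rightarrow> int \<times> int" where
  "letter_act c (S1, s) = shift (if s then 1 else -1)"
| "letter_act c (S2, s) = twist c (if s then 1 else -1)"

definition word_act :: "int \<Rightarrow> gen word \<Rightarrow> int \<times> int \<Rightarrow> int \<times> int" where
  "word_act c w = foldr (letter_act c) w"

lemma word_act_Nil [simp]: "word_act c [] x = x"
  by (simp add: word_act_def)

lemma word_act_Cons [simp]: "word_act c (l # w) x = letter_act c l (word_act c w x)"
  by (simp add: word_act_def)

lemma word_act_append [simp]: "word_act c (v @ w) x = word_act c v (word_act c w x)"
  by (simp add: word_act_def)

lemma shift_shift [simp]: "shift m (shift n x) = shift (m + n) x"
  by (cases x) (simp add: shift_def)

lemma shift_0 [simp]: "shift 0 x = x"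
  by (cases x) (simp add: shift_def)

lemma twist_0 [simp]: "twist c 0 x = x"
  by (cases x) (simp add: twist_def)

lemma triangle_add:
  "(m + n) * (m + n - 1) div 2 = m * (m - 1) div 2 + n * (n - 1) div 2 + m * n" for m n :: int
proof -
  have ev: "even (k * (k - 1))" for k :: int by simp
  obtain s where "m * (m - 1) = 2 * s" using ev by (rule evenE)
  moreover obtain t where "n * (n - 1) = 2 * t" using ev by (rule evenE)
  moreover from calculation have "(m + n) * (m + n - 1) = 2 * (s + t + m * n)"
    by (simp add: algebra_simps)
  ultimately show ?thesis by simp
qed

lemma twist_even: "twist c n (2 * m, l) = (2 * m, l + n * (1 + m * c))"
  by (simp add: twist_def)

lemma twist_odd:
  "twist c n (2 * m + 1, l) = (2 * (m - n) + 1, l - n - c * (n * m - n * (n - 1) div 2))"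
  by (simp add: twist_def)

text \<open>On odd exponents the first twist lowers i div 2 by n; the resulting term m*n is the
  cross term in \<open>triangle_add\<close>.\<close>

lemma twist_twist [simp]: "twist c m (twist c n x) = twist c (m + n) x"
proof (cases x)
  case (Pair i j)
  show ?thesis
  proof (cases "even i")
    case True
    then show ?thesis by (simp add: Pair twist_def algebra_simps)
  next
    case False
    then obtain k where i: "i = 2 * k + 1" by (blast elim: oddE)
    show ?thesis
      unfolding i Pair twist_odd triangle_add[of m n] by (simp add: algebra_simps)
  qed
qed

lemma word_act_gen_pow [simp]:
  "word_act c (gen_pow S1 k) x = shift k x"
  "word_act c (gen_pow S2 k) x = twist c k x"
proof -
  have *: "word_act c (replicate n (S1, s)) x = shift (int n * (if s then 1 else -1)) x"
    "word_act c (replicate n (S2, s)) x = twist c (int n * (if s then 1 else -1)) x" for n s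
    by (induction n) (simp_all add: algebra_simps)
  show "word_act c (gen_pow S1 k) x = shift k x" "word_act c (gen_pow S2 k) x = twist c k x"
    by (auto simp: gen_pow_def *)
qed

section \<open>The action modulo (p, q) respects the relations\<close>

definition cong2 :: "int \<Rightarrow> int \<Rightarrow> int \<times> int \<Rightarrow> int \<times> int \<Rightarrow> bool" where
  "cong2 p q x y \<longleftrightarrow> p dvd fst x - fst y \<and> q dvd snd x - snd y"

lemma cong2_refl [simp]: "cong2 p q x x"
  by (simp add: cong2_def)

lemma cong2_sym: "cong2 p q x y \<Longrightarrow> cong2 p q y x"
  by (auto simp: cong2_def dvd_diff_commute)

lemma cong2_trans: "cong2 p q x y \<Longrightarrow> cong2 p q y z \<Longrightarrow> cong2 p q x z"
  unfolding cong2_def by (metis diff_add_cancel diff_add_eq dvd_add add_diff_eq)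

lemma cong2_shift: "cong2 p q x y \<Longrightarrow> cong2 p q (shift n x) (shift n y)"
  by (auto simp: cong2_def shift_def split: prod.splits)

text \<open>Parity of the exponent of \<open>s1\<close> makes sense modulo p by
  \<open>p_even\<close>, and c*(i div 2) makes sense modulo q by \<open>two_q_dvd_cp\<close>. The
  factor 2 in \<open>two_q_dvd_cc\<close> is there because triangular numbers produce c*c/2. On odd
  exponents a twist by n shifts by 2n, whence \<open>p_dvd_2q\<close> for the relator of
  \<open>s2\<close> and \<open>p_dvd_2c\<close> for the last two relations. Chirality rests on
  \<open>not_q_dvd_2c\<close>.\<close>

locale gamma_parameters =
  fixes p q c :: int
  assumes p_even: "even p" and q_even: "even q"
    and p_dvd_2c: "p dvd 2 * c" and p_dvd_2q: "p dvd 2 * q"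
    and two_q_dvd_cp: "2 * q dvd c * p" and two_q_dvd_cc: "2 * q dvd c * c"
    and c_even: "even c" and not_q_dvd_2c: "\<not> q dvd 2 * c"
    and p_pos: "p > 0" and q_pos: "q > 0"
begin

lemma cong2_twist:
  assumes "cong2 p q x y"
  shows "cong2 p q (twist c n x) (twist c n y)"
proof -
  obtain i j k l where x: "x = (i, j)" and y: "y = (k, l)" by (cases x, cases y)
  have p: "p dvd i - k" and q: "q dvd j - l" using assms by (auto simp: cong2_def x y)
  have "even (i - k)" using p_even p by (rule dvd_trans)
  then have ev: "even i \<longleftrightarrow> even k" by simp
  \<comment> \<open>The halves of i and k differ by a multiple of p/2, and c*p/2 is a multiple of
    q.\<close>
  have "2 * q dvd c * (i - k)"
    using two_q_dvd_cp p by (rule dvd_trans[OF _ mult_dvd_mono[OF dvd_refl]])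
  moreover have "i - k = 2 * (i div 2 - k div 2)"
    using ev by (cases "even i") (auto elim!: evenE oddE)
  ultimately have "2 * q dvd 2 * (c * (i div 2 - k div 2))"
    by (metis mult.left_commute)
  then have m: "q dvd c * (i div 2 - k div 2)" by simp
  show ?thesis
  proof (cases "even i")
    case True
    have eq: "j + n * (1 + i div 2 * c) - (l + n * (1 + k div 2 * c)) =
        (j - l) + n * (c * (i div 2 - k div 2))" by (simp add: algebra_simps)
    have "q dvd j + n * (1 + i div 2 * c) - (l + n * (1 + k div 2 * c))"
      unfolding eq using q m by simp
    then show ?thesis using True ev p by (simp add: x y twist_def cong2_def)
  next
    case False
    have eq: "j - n - c * (n * (i div 2) - n * (n - 1) div 2) -
        (l - n - c * (n * (k div 2) - n * (n - 1) div 2)) =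
        (j - l) - n * (c * (i div 2 - k div 2))" by (simp add: algebra_simps)
    have "q dvd j - n - c * (n * (i div 2) - n * (n - 1) div 2) -
        (l - n - c * (n * (k div 2) - n * (n - 1) div 2))"
      unfolding eq using q m by simp
    then show ?thesis using False ev p by (simp add: x y twist_def cong2_def)
  qed
qed

lemma cong2_letter_act: "cong2 p q x y \<Longrightarrow> cong2 p q (letter_act c l x) (letter_act c l y)"
  by (cases "(c, l)" rule: letter_act.cases) (simp_all add: cong2_shift cong2_twist)

lemma cong2_word_act: "cong2 p q x y \<Longrightarrow> cong2 p q (word_act c w x) (word_act c w y)"
  by (induction w) (simp_all add: cong2_letter_act)

definition "rels = Gamma_rels p q 3 (1 + c) (-3) (-1 + c)"

lemma cong2_rel:
  assumes "(r, s) \<in> rels"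
  shows "cong2 p q (word_act c r x) (word_act c s x)"
proof -
  obtain i j where x: "x = (i, j)" by (cases x)
  obtain c' where c': "c = 2 * c'" using c_even by (blast elim: evenE)
  obtain q' where q': "q = 2 * q'" using q_even by (blast elim: evenE)
  obtain d where d: "c * c = 2 * q * d" using two_q_dvd_cc by (blast elim: dvdE)
  have S2q: "cong2 p q (twist c q x) x"
  proof (cases "even i")
    case True then show ?thesis by (simp add: x twist_def cong2_def)
  next
    case False
    \<comment> \<open>The triangular number contributes only half of q; the even factor c restores
      it.\<close>
    have "q * (q - 1) div 2 = q' * (q - 1)" by (simp add: q')
    then have "- q - c * (q * (i div 2) - q * (q - 1) div 2) =
        q * (- 1 - c * (i div 2) + c' * (q - 1))"
      by (simp add: c' q' algebra_simps)
    then have "q dvd - q - c * (q * (i div 2) - q * (q - 1) div 2)" by (rule dvdI)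
    then show ?thesis using False p_dvd_2q by (simp add: x twist_def cong2_def)
  qed
  have c'c: "c' * c = q * d" using d c' by (simp add: ac_simps)
  have invol: "shift 1 (twist c 1 (shift 1 (twist c 1 x))) = x"
  proof (cases "even i")
    case True
    then show ?thesis by (simp add: x shift_def twist_def)
  next
    case False
    then obtain m where "i = 2 * m + 1" by (blast elim: oddE)
    then show ?thesis by (simp add: x shift_def twist_def)
  qed
  have rel1: "cong2 p q (twist c (-1) (shift 1 x)) (shift 3 (twist c (1 + c) x))"
  proof (cases "even i")
    case True
    then obtain m where i: "i = 2 * m" by blast
    have sh: "shift 1 x = (2 * m + 1, j)" by (simp add: x i shift_def)
    \<comment> \<open>The two sides differ by c*c*m only, the error of the linear rule.\<close>
    have "j + 1 - c * (- m - 1) - (j + (1 + c) * (1 + m * c)) = q * (- 2 * d * m)"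
      using d by (simp add: algebra_simps)
    then have "q dvd j + 1 - c * (- m - 1) - (j + (1 + c) * (1 + m * c))" by (rule dvdI)
    then show ?thesis unfolding sh twist_odd unfolding x i twist_even
      by (simp add: shift_def cong2_def)
  next
    case False
    then obtain m where i: "i = 2 * m + 1" by (blast elim: oddE)
    have sh: "shift 1 x = (2 * (m + 1), j)" by (simp add: x i shift_def)
    have tri: "(1 + c) * (1 + c - 1) div 2 = c' * (1 + c)" by (simp add: c')
    have "(j + - 1 * (1 + (m + 1) * c)) - (j - (1 + c) - c * ((1 + c) * m - c' * (1 + c)))
        = c * c * m - c' * c * (1 + c)" by (simp add: algebra_simps)
    also have "\<dots> = q * (d * (2 * m - (1 + c)))"
      unfolding d c'c by (simp add: algebra_simps)
    finally have "(j + - 1 * (1 + (m + 1) * c)) -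
        (j - (1 + c) - c * ((1 + c) * m - c' * (1 + c))) = q * (d * (2 * m - (1 + c)))" .
    then have "q dvd (j + - 1 * (1 + (m + 1) * c)) -
        (j - (1 + c) - c * ((1 + c) * m - c' * (1 + c)))" by (rule dvdI)
    \<comment> \<open>On odd exponents the twist by 1 + c overshoots the first coordinate by
      2c.\<close>
    moreover have "2 * (m + 1) - (2 * (m - (1 + c)) + 1 + 3) = 2 * c" by simp
    ultimately show ?thesis using p_dvd_2c
      unfolding sh twist_even unfolding x i twist_odd tri
      by (simp only: cong2_def shift_def fst_conv snd_conv prod.case)
  qed
  have rel2: "cong2 p q (twist c 1 (shift (-1) x)) (shift (-3) (twist c (-1 + c) x))"
  proof (cases "even i")
    case True
    then obtain m where i: "i = 2 * m" by blast
    have sh: "shift (-1) x = (2 * (m - 1) + 1, j)" by (simp add: x i shift_def)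
    have "j - 1 - c * (m - 1) - (j + (-1 + c) * (1 + m * c)) = q * (- 2 * d * m)"
      using d by (simp add: algebra_simps)
    then have "q dvd j - 1 - c * (m - 1) - (j + (-1 + c) * (1 + m * c))" by (rule dvdI)
    then show ?thesis unfolding sh twist_odd unfolding x i twist_even
      by (simp add: shift_def cong2_def)
  next
    case False
    then obtain m where i: "i = 2 * m + 1" by (blast elim: oddE)
    have sh: "shift (-1) x = (2 * m, j)" by (simp add: x i shift_def)
    have tri2: "(- 1 + c) * (- 1 + c - 1) = 2 * ((c' - 1) * (c - 1))"
      by (simp add: c' algebra_simps)
    have tri: "(- 1 + c) * (- 1 + c - 1) div 2 = (c' - 1) * (c - 1)" unfolding tri2 by simp
    have "(j + 1 * (1 + m * c)) - (j - (-1 + c) - c * ((-1 + c) * m - (c' - 1) * (c - 1)))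
        = c * c * (m + 1) + c' * c * (1 - c)" by (simp add: algebra_simps)
    also have "\<dots> = q * (d * (2 * m - c + 3))"
      unfolding d c'c by (simp add: algebra_simps)
    finally have "(j + 1 * (1 + m * c)) -
        (j - (-1 + c) - c * ((-1 + c) * m - (c' - 1) * (c - 1))) = q * (d * (2 * m - c + 3))" .
    then have "q dvd (j + 1 * (1 + m * c)) -
        (j - (-1 + c) - c * ((-1 + c) * m - (c' - 1) * (c - 1)))" by (rule dvdI)
    moreover have "2 * m - (2 * (m - (-1 + c)) + 1 + -3) = 2 * c" by simp
    ultimately show ?thesis using p_dvd_2c
      unfolding sh twist_even unfolding x i twist_odd tri
      by (simp only: cong2_def shift_def fst_conv snd_conv prod.case)
  qed
  have S1p: "cong2 p q (shift p x) x" by (simp add: x shift_def cong2_def)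
  from assms show ?thesis
    unfolding rels_def Gamma_rels_def insert_iff empty_iff prod.inject
    by (elim disjE conjE FalseE)
      (simp_all only: word_act_append word_act_gen_pow word_act_Nil invol S1p S2q rel1 rel2 cong2_refl)
qed

text \<open>The action descends to the presented group modulo (p, q), which is what allows elements
  to be told apart.\<close>

lemma cong2_word_eq: "word_eq rels v w \<Longrightarrow> cong2 p q (word_act c v x) (word_act c w x)"
proof (induction arbitrary: x rule: word_eq.induct)
  case (sym v w)
  then show ?case by (blast intro: cong2_sym)
next
  case (trans u v w)
  then show ?case by (blast intro: cong2_trans)
next
  case (cancel u y s v)
  have "letter_act c (y, s) (letter_act c (y, \<not> s) z) = z" for z
    by (cases y) simp_all
  then show ?case by simp
next
  case (rel r s u v)
  then show ?case by (simp add: cong2_word_act cong2_rel)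
qed simp

end

section \<open>Normal forms in the presented group\<close>

lemma presented_group_gen_False:
  "word_class R [(x, False)] = inv\<^bsub>presented_group R\<^esub> presented_gen R x"
proof -
  interpret group "presented_group R" by (rule group_presented_group)
  have "word_class R [(x, False)] \<otimes>\<^bsub>presented_group R\<^esub> presented_gen R x = \<one>\<^bsub>presented_group R\<^esub>"
    using word_eq.cancel[of R "[]" x False "[]"]
    by (simp add: presented_gen_def presented_group_mult word_class_eq_iff)
      (simp add: presented_group_def word_class_eq_iff)
  then show ?thesis
    by (rule inv_equality[symmetric]) (auto simp: presented_gen_def presented_group_def)
qed

lemma word_class_gen_pow:
  "word_class R (gen_pow x k) = presented_gen R x [^]\<^bsub>presented_group R\<^esub> k"
proof -
  interpret group "presented_group R" by (rule group_presented_group)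
  have closed [simp]: "presented_gen R x \<in> carrier (presented_group R)"
    by (auto simp: presented_gen_def presented_group_def)
  have rep: "word_class R (replicate n (x, s)) = word_class R [(x, s)] [^]\<^bsub>presented_group R\<^esub> n" for n s
  proof (induction n)
    case 0
    then show ?case by (simp add: presented_group_def)
  next
    case (Suc n)
    have "replicate (Suc n) (x, s) = replicate n (x, s) @ [(x, s)]"
      by (simp add: replicate_append_same)
    then show ?case by (simp only: presented_group_mult[symmetric] Suc nat_pow_Suc)
  qed
  show ?thesis
  proof (cases k rule: int_cases2)
    case (nonneg n)
    then show ?thesis using rep[of n True] by (simp add: gen_pow_def presented_gen_def int_pow_int)
  next
    case (nonpos n)
    then show ?thesis using rep[of n False] rep[of 0 True]
      by (cases "n = 0")
        (simp_all add: gen_pow_def int_pow_neg_int presented_group_gen_False nat_pow_inv)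
  qed
qed

lemma (in group) int_pow_move_past:
  assumes zxy: "x \<otimes> z = z \<otimes> y" and [simp]: "x \<in> carrier G" "y \<in> carrier G" "z \<in> carrier G"
  shows "x [^] (n :: int) \<otimes> z = z \<otimes> y [^] n"
proof -
  have nat: "x [^] m \<otimes> z = z \<otimes> y [^] m" for m :: nat
  proof (induction m)
    case (Suc m)
    have "x [^] Suc m \<otimes> z = x [^] m \<otimes> (x \<otimes> z)" by (simp add: m_assoc)
    also have "\<dots> = (x [^] m \<otimes> z) \<otimes> y" by (simp add: zxy m_assoc)
    finally show ?case by (simp add: Suc m_assoc)
  qed simp
  have "inv (x [^] m) \<otimes> z = z \<otimes> inv (y [^] m)" for m :: nat
  proof -
    have "inv (x [^] m) \<otimes> z = inv (x [^] m) \<otimes> (z \<otimes> y [^] m) \<otimes> inv (y [^] m)"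
      by (simp add: m_assoc)
    also have "\<dots> = inv (x [^] m) \<otimes> (x [^] m \<otimes> z) \<otimes> inv (y [^] m)"
      by (simp only: nat)
    also have "\<dots> = z \<otimes> inv (y [^] m)" by (simp add: m_assoc[symmetric])
    finally show ?thesis .
  qed
  then show ?thesis using nat
    by (cases n rule: int_cases2) (simp_all add: int_pow_int int_pow_neg_int)
qed

lemma (in group) inverting_map_int_pow:
  assumes [simp]: "x \<in> carrier G" and \<tau>: "\<tau> \<in> carrier G \<rightarrow> carrier G"
    and inv: "\<And>g. g \<in> carrier G \<Longrightarrow> \<tau> (g \<otimes> x) = \<tau> g \<otimes> inv x" and g: "g \<in> carrier G"
  shows "\<tau> (g \<otimes> x [^] (n :: int)) = \<tau> g \<otimes> x [^] (- n)"
proof -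
  have c: "\<tau> h \<in> carrier G" if "h \<in> carrier G" for h using \<tau> that by auto
  have pos: "\<tau> (h \<otimes> x [^] m) = \<tau> h \<otimes> inv (x [^] m)" if "h \<in> carrier G" for h and m :: nat
  proof (induction m)
    case (Suc m)
    have "\<tau> (h \<otimes> x [^] Suc m) = \<tau> (h \<otimes> x [^] m) \<otimes> inv x"
      using inv[of "h \<otimes> x [^] m"] that by (simp add: m_assoc)
    also have "\<dots> = \<tau> h \<otimes> inv (x [^] m \<otimes> x)"
      using that c[OF that] Suc by (simp add: m_assoc inv_mult_group[symmetric] nat_pow_Suc2[symmetric])
    finally show ?case by simp
  qed (use that c in simp)
  \<comment> \<open>Obtained by applying the positive case at g x^-m and solving for its
    image.\<close>
  have neg: "\<tau> (g \<otimes> inv (x [^] m)) = \<tau> g \<otimes> x [^] m" for m :: nat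
    using pos[of "g \<otimes> inv (x [^] m)" m] g c[OF g] c[of "g \<otimes> inv (x [^] m)"]
    by (simp add: m_assoc inv_solve_right)
  show ?thesis
    by (cases n rule: int_cases2) (simp_all add: int_pow_int int_pow_neg_int pos[OF g] neg)
qed

section \<open>Relations and normal forms in the presented group\<close>

context gamma_parameters
begin

abbreviation "\<Gamma> \<equiv> presented_group rels"
abbreviation "s1 \<equiv> presented_gen rels S1"
abbreviation "s2 \<equiv> presented_gen rels S2"

sublocale \<Gamma>: group \<Gamma> by (rule group_presented_group)

lemma gen_closed [simp]: "presented_gen rels x \<in> carrier \<Gamma>"
  by (auto simp: presented_gen_def presented_group_def)

lemma one_\<Gamma>: "word_class rels [] = \<one>\<^bsub>\<Gamma>\<^esub>"
  by (simp add: presented_group_def)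

lemma \<Gamma>_relation:
  assumes "(r, s) \<in> rels"
  shows "word_class rels r = word_class rels s"
  using word_eq.rel[OF assms, of "[]" "[]"] by (simp add: word_class_eq_iff)

lemma \<Gamma>_relations:
  "s1 [^]\<^bsub>\<Gamma>\<^esub> p = \<one>\<^bsub>\<Gamma>\<^esub>" "s2 [^]\<^bsub>\<Gamma>\<^esub> q = \<one>\<^bsub>\<Gamma>\<^esub>"
  "s1 \<otimes>\<^bsub>\<Gamma>\<^esub> s2 \<otimes>\<^bsub>\<Gamma>\<^esub> s1 \<otimes>\<^bsub>\<Gamma>\<^esub> s2 = \<one>\<^bsub>\<Gamma>\<^esub>"
  "inv\<^bsub>\<Gamma>\<^esub> s2 \<otimes>\<^bsub>\<Gamma>\<^esub> s1 = s1 [^]\<^bsub>\<Gamma>\<^esub> (3 :: int) \<otimes>\<^bsub>\<Gamma>\<^esub> s2 [^]\<^bsub>\<Gamma>\<^esub> (1 + c)"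
proof -
  have w: "word_class rels (gen_pow S1 1 @ gen_pow S2 1 @ gen_pow S1 1 @ gen_pow S2 1) = word_class rels []"
    "word_class rels (gen_pow S2 (-1) @ gen_pow S1 1) = word_class rels (gen_pow S1 3 @ gen_pow S2 (1 + c))"
    by (rule \<Gamma>_relation, simp add: rels_def Gamma_rels_def)+
  show "s1 [^]\<^bsub>\<Gamma>\<^esub> p = \<one>\<^bsub>\<Gamma>\<^esub>" "s2 [^]\<^bsub>\<Gamma>\<^esub> q = \<one>\<^bsub>\<Gamma>\<^esub>"
    unfolding word_class_gen_pow[symmetric] one_\<Gamma>[symmetric]
    by (rule \<Gamma>_relation, simp add: rels_def Gamma_rels_def)+
  show "s1 \<otimes>\<^bsub>\<Gamma>\<^esub> s2 \<otimes>\<^bsub>\<Gamma>\<^esub> s1 \<otimes>\<^bsub>\<Gamma>\<^esub> s2 = \<one>\<^bsub>\<Gamma>\<^esub>"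
    using w(1) unfolding presented_group_mult[symmetric] word_class_gen_pow one_\<Gamma>
    by (simp add: \<Gamma>.m_assoc)
  show "inv\<^bsub>\<Gamma>\<^esub> s2 \<otimes>\<^bsub>\<Gamma>\<^esub> s1 = s1 [^]\<^bsub>\<Gamma>\<^esub> (3 :: int) \<otimes>\<^bsub>\<Gamma>\<^esub> s2 [^]\<^bsub>\<Gamma>\<^esub> (1 + c)"
    using w(2) unfolding presented_group_mult[symmetric] word_class_gen_pow
    by (simp add: \<Gamma>.int_pow_neg)
qed

text \<open>A normal form sends the pair (0, 0) to its own exponents.\<close>

lemma \<Gamma>_pow_mult_eqD:
  assumes "s1 [^]\<^bsub>\<Gamma>\<^esub> i \<otimes>\<^bsub>\<Gamma>\<^esub> s2 [^]\<^bsub>\<Gamma>\<^esub> j = s1 [^]\<^bsub>\<Gamma>\<^esub> k \<otimes>\<^bsub>\<Gamma>\<^esub> s2 [^]\<^bsub>\<Gamma>\<^esub> l"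
  shows "p dvd i - k" "q dvd j - l"
proof -
  have "word_eq rels (gen_pow S1 i @ gen_pow S2 j) (gen_pow S1 k @ gen_pow S2 l)"
    using assms
    unfolding word_class_gen_pow[symmetric] presented_group_mult word_class_eq_iff .
  from cong2_word_eq[OF this, of "(0, 0)"] show "p dvd i - k" "q dvd j - l"
    by (simp_all add: cong2_def twist_def shift_def)
qed

lemma s2_s1: "s2 \<otimes>\<^bsub>\<Gamma>\<^esub> s1 = inv\<^bsub>\<Gamma>\<^esub> s1 \<otimes>\<^bsub>\<Gamma>\<^esub> inv\<^bsub>\<Gamma>\<^esub> s2"
proof -
  have "s1 \<otimes>\<^bsub>\<Gamma>\<^esub> (s2 \<otimes>\<^bsub>\<Gamma>\<^esub> s1 \<otimes>\<^bsub>\<Gamma>\<^esub> s2) = \<one>\<^bsub>\<Gamma>\<^esub>" using \<Gamma>_relations(3) by (simp add: \<Gamma>.m_assoc)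
  then have "s2 \<otimes>\<^bsub>\<Gamma>\<^esub> s1 \<otimes>\<^bsub>\<Gamma>\<^esub> s2 = inv\<^bsub>\<Gamma>\<^esub> s1"
    by (metis \<Gamma>.inv_comm \<Gamma>.inv_equality \<Gamma>.m_closed gen_closed)
  then show ?thesis by (metis \<Gamma>.inv_closed \<Gamma>.inv_solve_right \<Gamma>.m_closed gen_closed)
qed

text \<open>Rewriting \<open>s2\<close> \<open>s1\<close> as \<open>s1\<close>^-1
  \<open>s2\<close>^-1 exposes the left side of the fourth relation; the exponent 3 then drops to
  2.\<close>

lemma s2_s1_square: "s2 \<otimes>\<^bsub>\<Gamma>\<^esub> s1 [^]\<^bsub>\<Gamma>\<^esub> (2 :: int) = s1 [^]\<^bsub>\<Gamma>\<^esub> (2 :: int) \<otimes>\<^bsub>\<Gamma>\<^esub> s2 [^]\<^bsub>\<Gamma>\<^esub> (1 + c)"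
proof -
  have sq: "s1 [^]\<^bsub>\<Gamma>\<^esub> (2 :: int) = s1 \<otimes>\<^bsub>\<Gamma>\<^esub> s1"
    using \<Gamma>.int_pow_mult[of s1 1 1] by simp
  have cube: "inv\<^bsub>\<Gamma>\<^esub> s1 \<otimes>\<^bsub>\<Gamma>\<^esub> s1 [^]\<^bsub>\<Gamma>\<^esub> (3 :: int) = s1 [^]\<^bsub>\<Gamma>\<^esub> (2 :: int)"
    using \<Gamma>.int_pow_mult[of s1 "-1" 3] by (simp add: \<Gamma>.int_pow_neg)
  have "s2 \<otimes>\<^bsub>\<Gamma>\<^esub> s1 [^]\<^bsub>\<Gamma>\<^esub> (2 :: int) = (s2 \<otimes>\<^bsub>\<Gamma>\<^esub> s1) \<otimes>\<^bsub>\<Gamma>\<^esub> s1"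
    by (simp add: sq \<Gamma>.m_assoc)
  also have "\<dots> = inv\<^bsub>\<Gamma>\<^esub> s1 \<otimes>\<^bsub>\<Gamma>\<^esub> (inv\<^bsub>\<Gamma>\<^esub> s2 \<otimes>\<^bsub>\<Gamma>\<^esub> s1)"
    unfolding s2_s1 by (simp add: \<Gamma>.m_assoc)
  also have "\<dots> = (inv\<^bsub>\<Gamma>\<^esub> s1 \<otimes>\<^bsub>\<Gamma>\<^esub> s1 [^]\<^bsub>\<Gamma>\<^esub> (3 :: int)) \<otimes>\<^bsub>\<Gamma>\<^esub> s2 [^]\<^bsub>\<Gamma>\<^esub> (1 + c)"
    unfolding \<Gamma>_relations(4) by (simp add: \<Gamma>.m_assoc)
  finally show ?thesis unfolding cube .
qed

definition normal_forms :: "gen word set set" where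
  "normal_forms = {s1 [^]\<^bsub>\<Gamma>\<^esub> (i :: int) \<otimes>\<^bsub>\<Gamma>\<^esub> s2 [^]\<^bsub>\<Gamma>\<^esub> (j :: int) | i j. True}"

lemma normal_formsI: "s1 [^]\<^bsub>\<Gamma>\<^esub> (i :: int) \<otimes>\<^bsub>\<Gamma>\<^esub> s2 [^]\<^bsub>\<Gamma>\<^esub> (j :: int) \<in> normal_forms"
  by (auto simp: normal_forms_def)

text \<open>Iterating \<open>s2_s1_square\<close> multiplies the exponent of \<open>s2\<close> by 1
  + c a total of m times. Only existence is needed, and m is natural so that this power is an
  integer.\<close>

lemma s2_pow_s1_even:
  obtains l :: int where
    "s2 [^]\<^bsub>\<Gamma>\<^esub> (j :: int) \<otimes>\<^bsub>\<Gamma>\<^esub> s1 [^]\<^bsub>\<Gamma>\<^esub> (2 * int m) = s1 [^]\<^bsub>\<Gamma>\<^esub> (2 * int m) \<otimes>\<^bsub>\<Gamma>\<^esub> s2 [^]\<^bsub>\<Gamma>\<^esub> l"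
proof -
  have "\<exists>u :: int. s2 \<otimes>\<^bsub>\<Gamma>\<^esub> s1 [^]\<^bsub>\<Gamma>\<^esub> (2 * int m) = s1 [^]\<^bsub>\<Gamma>\<^esub> (2 * int m) \<otimes>\<^bsub>\<Gamma>\<^esub> s2 [^]\<^bsub>\<Gamma>\<^esub> u"
  proof (induction m)
    case 0
    have "s2 \<otimes>\<^bsub>\<Gamma>\<^esub> s1 [^]\<^bsub>\<Gamma>\<^esub> (2 * int 0) = s1 [^]\<^bsub>\<Gamma>\<^esub> (2 * int 0) \<otimes>\<^bsub>\<Gamma>\<^esub> s2 [^]\<^bsub>\<Gamma>\<^esub> (1 :: int)" by simp
    then show ?case ..
  next
    case (Suc m)
    then obtain u :: int where
      u: "s2 \<otimes>\<^bsub>\<Gamma>\<^esub> s1 [^]\<^bsub>\<Gamma>\<^esub> (2 * int m) = s1 [^]\<^bsub>\<Gamma>\<^esub> (2 * int m) \<otimes>\<^bsub>\<Gamma>\<^esub> s2 [^]\<^bsub>\<Gamma>\<^esub> u" by blast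
    have pow: "s1 [^]\<^bsub>\<Gamma>\<^esub> (2 * int (Suc m)) = s1 [^]\<^bsub>\<Gamma>\<^esub> (2 * int m) \<otimes>\<^bsub>\<Gamma>\<^esub> s1 [^]\<^bsub>\<Gamma>\<^esub> (2 :: int)"
      by (simp add: \<Gamma>.int_pow_mult[symmetric] add.commute)
    have "s2 \<otimes>\<^bsub>\<Gamma>\<^esub> s1 [^]\<^bsub>\<Gamma>\<^esub> (2 * int (Suc m)) =
        s1 [^]\<^bsub>\<Gamma>\<^esub> (2 * int m) \<otimes>\<^bsub>\<Gamma>\<^esub> (s2 [^]\<^bsub>\<Gamma>\<^esub> u \<otimes>\<^bsub>\<Gamma>\<^esub> s1 [^]\<^bsub>\<Gamma>\<^esub> (2 :: int))"
      unfolding pow using u by (simp add: \<Gamma>.m_assoc[symmetric])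
    also have "s2 [^]\<^bsub>\<Gamma>\<^esub> u \<otimes>\<^bsub>\<Gamma>\<^esub> s1 [^]\<^bsub>\<Gamma>\<^esub> (2 :: int) =
        s1 [^]\<^bsub>\<Gamma>\<^esub> (2 :: int) \<otimes>\<^bsub>\<Gamma>\<^esub> s2 [^]\<^bsub>\<Gamma>\<^esub> ((1 + c) * u)"
      using \<Gamma>.int_pow_move_past[OF s2_s1_square, of u] by (simp add: \<Gamma>.int_pow_pow)
    also have "s1 [^]\<^bsub>\<Gamma>\<^esub> (2 * int m) \<otimes>\<^bsub>\<Gamma>\<^esub> \<dots> = s1 [^]\<^bsub>\<Gamma>\<^esub> (2 * int (Suc m)) \<otimes>\<^bsub>\<Gamma>\<^esub> s2 [^]\<^bsub>\<Gamma>\<^esub> ((1 + c) * u)"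
      unfolding pow by (simp add: \<Gamma>.m_assoc)
    finally show ?case by blast
  qed
  then obtain u :: int where
    "s2 \<otimes>\<^bsub>\<Gamma>\<^esub> s1 [^]\<^bsub>\<Gamma>\<^esub> (2 * int m) = s1 [^]\<^bsub>\<Gamma>\<^esub> (2 * int m) \<otimes>\<^bsub>\<Gamma>\<^esub> s2 [^]\<^bsub>\<Gamma>\<^esub> u" by blast
  from \<Gamma>.int_pow_move_past[OF this, of j] show thesis
    by (intro that[of "u * j"]) (simp add: \<Gamma>.int_pow_pow)
qed

lemma normal_forms_s1:
  assumes "N \<in> normal_forms"
  shows "s1 [^]\<^bsub>\<Gamma>\<^esub> (e :: int) \<otimes>\<^bsub>\<Gamma>\<^esub> N \<in> normal_forms"
proof -
  obtain i j :: int where "N = s1 [^]\<^bsub>\<Gamma>\<^esub> i \<otimes>\<^bsub>\<Gamma>\<^esub> s2 [^]\<^bsub>\<Gamma>\<^esub> j"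
    using assms by (auto simp: normal_forms_def)
  then have "s1 [^]\<^bsub>\<Gamma>\<^esub> e \<otimes>\<^bsub>\<Gamma>\<^esub> N = s1 [^]\<^bsub>\<Gamma>\<^esub> (e + i) \<otimes>\<^bsub>\<Gamma>\<^esub> s2 [^]\<^bsub>\<Gamma>\<^esub> j"
    by (simp add: \<Gamma>.int_pow_mult \<Gamma>.m_assoc)
  then show ?thesis using normal_formsI by simp
qed

lemma normal_forms_s2:
  assumes "N \<in> normal_forms" and e: "e = 1 \<or> e = (-1 :: int)"
  shows "s2 [^]\<^bsub>\<Gamma>\<^esub> e \<otimes>\<^bsub>\<Gamma>\<^esub> N \<in> normal_forms"
proof -
  obtain i j :: int where N: "N = s1 [^]\<^bsub>\<Gamma>\<^esub> i \<otimes>\<^bsub>\<Gamma>\<^esub> s2 [^]\<^bsub>\<Gamma>\<^esub> j"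
    using assms by (auto simp: normal_forms_def)
  \<comment> \<open>Reducing i modulo p makes the exponent nonnegative, as
    \<open>s2_pow_s1_even\<close> requires.\<close>
  define m where "m = nat (i mod p div 2)"
  have even_case: "s2 [^]\<^bsub>\<Gamma>\<^esub> (v :: int) \<otimes>\<^bsub>\<Gamma>\<^esub> (s1 [^]\<^bsub>\<Gamma>\<^esub> (2 * int m) \<otimes>\<^bsub>\<Gamma>\<^esub> s2 [^]\<^bsub>\<Gamma>\<^esub> j) \<in> normal_forms" for v
  proof -
    obtain l :: int where l:
      "s2 [^]\<^bsub>\<Gamma>\<^esub> v \<otimes>\<^bsub>\<Gamma>\<^esub> s1 [^]\<^bsub>\<Gamma>\<^esub> (2 * int m) = s1 [^]\<^bsub>\<Gamma>\<^esub> (2 * int m) \<otimes>\<^bsub>\<Gamma>\<^esub> s2 [^]\<^bsub>\<Gamma>\<^esub> l"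
      by (rule s2_pow_s1_even)
    have "s2 [^]\<^bsub>\<Gamma>\<^esub> v \<otimes>\<^bsub>\<Gamma>\<^esub> (s1 [^]\<^bsub>\<Gamma>\<^esub> (2 * int m) \<otimes>\<^bsub>\<Gamma>\<^esub> s2 [^]\<^bsub>\<Gamma>\<^esub> j) =
        (s2 [^]\<^bsub>\<Gamma>\<^esub> v \<otimes>\<^bsub>\<Gamma>\<^esub> s1 [^]\<^bsub>\<Gamma>\<^esub> (2 * int m)) \<otimes>\<^bsub>\<Gamma>\<^esub> s2 [^]\<^bsub>\<Gamma>\<^esub> j"
      by (simp add: \<Gamma>.m_assoc)
    also have "\<dots> = s1 [^]\<^bsub>\<Gamma>\<^esub> (2 * int m) \<otimes>\<^bsub>\<Gamma>\<^esub> s2 [^]\<^bsub>\<Gamma>\<^esub> (l + j)"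
      unfolding l by (simp add: \<Gamma>.m_assoc \<Gamma>.int_pow_mult)
    finally show ?thesis using normal_formsI by simp
  qed
  have "i = p * (i div p) + i mod p" by simp
  then have "s1 [^]\<^bsub>\<Gamma>\<^esub> i = (s1 [^]\<^bsub>\<Gamma>\<^esub> p) [^]\<^bsub>\<Gamma>\<^esub> (i div p) \<otimes>\<^bsub>\<Gamma>\<^esub> s1 [^]\<^bsub>\<Gamma>\<^esub> (i mod p)"
    by (metis \<Gamma>.int_pow_mult \<Gamma>.int_pow_pow gen_closed)
  then have i: "s1 [^]\<^bsub>\<Gamma>\<^esub> i = s1 [^]\<^bsub>\<Gamma>\<^esub> (i mod p)" by (simp add: \<Gamma>_relations)
  have m: "int m = i mod p div 2" using p_pos by (simp add: m_def)
  show ?thesis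
  proof (cases "even (i mod p)")
    case True
    then have "i mod p = 2 * int m" using m by simp
    then show ?thesis using even_case by (simp add: N i)
  next
    case False
    have im: "i mod p = 1 + 2 * int m"
      unfolding m using odd_two_times_div_two_succ[OF False] by linarith
    \<comment> \<open>One factor \<open>s1\<close> is split off and exchanged with the single letter
      on its left; an even power of \<open>s1\<close> remains.\<close>
    obtain u v :: int where uv: "s2 [^]\<^bsub>\<Gamma>\<^esub> e \<otimes>\<^bsub>\<Gamma>\<^esub> s1 = s1 [^]\<^bsub>\<Gamma>\<^esub> u \<otimes>\<^bsub>\<Gamma>\<^esub> s2 [^]\<^bsub>\<Gamma>\<^esub> v"
    proof -
      have "s2 [^]\<^bsub>\<Gamma>\<^esub> (1 :: int) \<otimes>\<^bsub>\<Gamma>\<^esub> s1 = s1 [^]\<^bsub>\<Gamma>\<^esub> (-1 :: int) \<otimes>\<^bsub>\<Gamma>\<^esub> s2 [^]\<^bsub>\<Gamma>\<^esub> (-1 :: int)"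
        by (simp add: s2_s1 \<Gamma>.int_pow_neg)
      moreover have "s2 [^]\<^bsub>\<Gamma>\<^esub> (-1 :: int) \<otimes>\<^bsub>\<Gamma>\<^esub> s1 = s1 [^]\<^bsub>\<Gamma>\<^esub> (3 :: int) \<otimes>\<^bsub>\<Gamma>\<^esub> s2 [^]\<^bsub>\<Gamma>\<^esub> (1 + c)"
        by (simp add: \<Gamma>_relations \<Gamma>.int_pow_neg)
      ultimately show thesis using e that by blast
    qed
    have "s2 [^]\<^bsub>\<Gamma>\<^esub> e \<otimes>\<^bsub>\<Gamma>\<^esub> N =
        (s2 [^]\<^bsub>\<Gamma>\<^esub> e \<otimes>\<^bsub>\<Gamma>\<^esub> s1) \<otimes>\<^bsub>\<Gamma>\<^esub> (s1 [^]\<^bsub>\<Gamma>\<^esub> (2 * int m) \<otimes>\<^bsub>\<Gamma>\<^esub> s2 [^]\<^bsub>\<Gamma>\<^esub> j)"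
      unfolding N i im by (simp add: \<Gamma>.int_pow_mult \<Gamma>.m_assoc)
    also have "\<dots> = s1 [^]\<^bsub>\<Gamma>\<^esub> u \<otimes>\<^bsub>\<Gamma>\<^esub> (s2 [^]\<^bsub>\<Gamma>\<^esub> v \<otimes>\<^bsub>\<Gamma>\<^esub> (s1 [^]\<^bsub>\<Gamma>\<^esub> (2 * int m) \<otimes>\<^bsub>\<Gamma>\<^esub> s2 [^]\<^bsub>\<Gamma>\<^esub> j))"
      unfolding uv by (simp add: \<Gamma>.m_assoc)
    finally show ?thesis using normal_forms_s1[OF even_case] by simp
  qed
qed

lemma word_class_normal_form: "word_class rels w \<in> normal_forms"
proof (induction w)
  case Nil
  show ?case using normal_formsI[of 0 0] by (simp add: one_\<Gamma>)
next
  case (Cons l w)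
  obtain x s where l: "l = (x, s)" by (cases l)
  define e :: int where "e = (if s then 1 else -1)"
  have "word_class rels (l # w) = word_class rels (gen_pow x e) \<otimes>\<^bsub>\<Gamma>\<^esub> word_class rels w"
    by (simp add: presented_group_mult l e_def gen_pow_def)
  also have "\<dots> = presented_gen rels x [^]\<^bsub>\<Gamma>\<^esub> e \<otimes>\<^bsub>\<Gamma>\<^esub> word_class rels w"
    by (simp only: word_class_gen_pow)
  also have "\<dots> \<in> normal_forms"
    using Cons normal_forms_s1 normal_forms_s2 by (cases x) (simp_all add: e_def)
  finally show ?case .
qed

lemma no_inverting_map_\<Gamma>:
  assumes \<tau>: "\<tau> \<in> carrier \<Gamma> \<rightarrow> carrier \<Gamma>"
    and \<tau>1: "\<And>g. g \<in> carrier \<Gamma> \<Longrightarrow> \<tau> (g \<otimes>\<^bsub>\<Gamma>\<^esub> s1) = \<tau> g \<otimes>\<^bsub>\<Gamma>\<^esub> inv\<^bsub>\<Gamma>\<^esub> s1"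
    and \<tau>2: "\<And>g. g \<in> carrier \<Gamma> \<Longrightarrow> \<tau> (g \<otimes>\<^bsub>\<Gamma>\<^esub> s2) = \<tau> g \<otimes>\<^bsub>\<Gamma>\<^esub> inv\<^bsub>\<Gamma>\<^esub> s2"
  shows False
proof -
  note A = \<Gamma>.inverting_map_int_pow[OF gen_closed \<tau> \<tau>1]
  note B = \<Gamma>.inverting_map_int_pow[OF gen_closed \<tau> \<tau>2]
  have t: "\<tau> \<one>\<^bsub>\<Gamma>\<^esub> \<in> carrier \<Gamma>" using \<tau> by auto
  have "\<tau> (\<one>\<^bsub>\<Gamma>\<^esub> \<otimes>\<^bsub>\<Gamma>\<^esub> s2 [^]\<^bsub>\<Gamma>\<^esub> (1 :: int) \<otimes>\<^bsub>\<Gamma>\<^esub> s1 [^]\<^bsub>\<Gamma>\<^esub> (2 :: int)) =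
      \<tau> (\<one>\<^bsub>\<Gamma>\<^esub> \<otimes>\<^bsub>\<Gamma>\<^esub> s1 [^]\<^bsub>\<Gamma>\<^esub> (2 :: int) \<otimes>\<^bsub>\<Gamma>\<^esub> s2 [^]\<^bsub>\<Gamma>\<^esub> (1 + c))"
    by (simp add: s2_s1_square)
  then have "\<tau> \<one>\<^bsub>\<Gamma>\<^esub> \<otimes>\<^bsub>\<Gamma>\<^esub> s2 [^]\<^bsub>\<Gamma>\<^esub> (-1 :: int) \<otimes>\<^bsub>\<Gamma>\<^esub> s1 [^]\<^bsub>\<Gamma>\<^esub> (-2 :: int) =
      \<tau> \<one>\<^bsub>\<Gamma>\<^esub> \<otimes>\<^bsub>\<Gamma>\<^esub> s1 [^]\<^bsub>\<Gamma>\<^esub> (-2 :: int) \<otimes>\<^bsub>\<Gamma>\<^esub> s2 [^]\<^bsub>\<Gamma>\<^esub> (- (1 + c))"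
    by (simp only: A B \<Gamma>.m_closed \<Gamma>.int_pow_closed gen_closed \<Gamma>.one_closed)
  then have "s2 [^]\<^bsub>\<Gamma>\<^esub> (-1 :: int) \<otimes>\<^bsub>\<Gamma>\<^esub> s1 [^]\<^bsub>\<Gamma>\<^esub> (-2 :: int) =
      s1 [^]\<^bsub>\<Gamma>\<^esub> (-2 :: int) \<otimes>\<^bsub>\<Gamma>\<^esub> s2 [^]\<^bsub>\<Gamma>\<^esub> (- (1 + c))"
    using t by (simp add: \<Gamma>.m_assoc)
  then have "word_eq rels (gen_pow S2 (-1) @ gen_pow S1 (-2)) (gen_pow S1 (-2) @ gen_pow S2 (- (1 + c)))"
    unfolding word_class_gen_pow[symmetric] presented_group_mult word_class_eq_iff .
  \<comment> \<open>At (0, 0) the left word produces the second coordinate -(1 - c), the right word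
    -(1 + c).\<close>
  from cong2_word_eq[OF this, of "(0, 0)"] have "q dvd 2 * c"
    by (simp add: cong2_def twist_def shift_def)
  then show False using not_q_dvd_2c by simp
qed

theorem tight_rotation_group_\<Gamma>: "tight_rotation_group \<Gamma> s1 s2 (nat p) (nat q)"
proof unfold_locales
  have "1 < p" using p_pos p_even by presburger
  then show "1 < nat p" by simp
  have "1 < q" using q_pos q_even by presburger
  then show "1 < nat q" by simp
  show "\<exists>(i :: int) (j :: int). g = s1 [^]\<^bsub>\<Gamma>\<^esub> i \<otimes>\<^bsub>\<Gamma>\<^esub> s2 [^]\<^bsub>\<Gamma>\<^esub> j" if "g \<in> carrier \<Gamma>" for g
  proof -
    obtain w where "g = word_class rels w" using \<open>g \<in> carrier \<Gamma>\<close> by (auto simp: presented_group_def)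
    then show ?thesis using word_class_normal_form[of w] by (auto simp: normal_forms_def)
  qed
  show "s1 [^]\<^bsub>\<Gamma>\<^esub> i \<otimes>\<^bsub>\<Gamma>\<^esub> s2 [^]\<^bsub>\<Gamma>\<^esub> j = \<one>\<^bsub>\<Gamma>\<^esub> \<longleftrightarrow> int (nat p) dvd i \<and> int (nat q) dvd j" for i j :: int
  proof
    assume "s1 [^]\<^bsub>\<Gamma>\<^esub> i \<otimes>\<^bsub>\<Gamma>\<^esub> s2 [^]\<^bsub>\<Gamma>\<^esub> j = \<one>\<^bsub>\<Gamma>\<^esub>"
    then show "int (nat p) dvd i \<and> int (nat q) dvd j"
      using \<Gamma>_pow_mult_eqD[of i j 0 0] p_pos q_pos by simp
  next
    assume "int (nat p) dvd i \<and> int (nat q) dvd j"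
    then obtain k l where "i = p * k" "j = q * l" using p_pos q_pos by (auto elim!: dvdE)
    then show "s1 [^]\<^bsub>\<Gamma>\<^esub> i \<otimes>\<^bsub>\<Gamma>\<^esub> s2 [^]\<^bsub>\<Gamma>\<^esub> j = \<one>\<^bsub>\<Gamma>\<^esub>"
      by (simp add: \<Gamma>.int_pow_pow[symmetric] \<Gamma>_relations)
  qed
  show False if "\<tau> \<in> carrier \<Gamma> \<rightarrow> carrier \<Gamma>"
      "\<And>g. g \<in> carrier \<Gamma> \<Longrightarrow> \<tau> (g \<otimes>\<^bsub>\<Gamma>\<^esub> s1) = \<tau> g \<otimes>\<^bsub>\<Gamma>\<^esub> inv\<^bsub>\<Gamma>\<^esub> s1"
      "\<And>g. g \<in> carrier \<Gamma> \<Longrightarrow> \<tau> (g \<otimes>\<^bsub>\<Gamma>\<^esub> s2) = \<tau> g \<otimes>\<^bsub>\<Gamma>\<^esub> inv\<^bsub>\<Gamma>\<^esub> s2" for \<tau>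
    using that by (rule no_inverting_map_\<Gamma>)
qed (fact gen_closed \<Gamma>_relations(3))+

corollary Gamma_tight_chiral:
  "\<exists>X :: nat ranked_poset. polyhedron X \<and> chiral X \<and> tight X (nat p) (nat q) \<and>
     is_aut_group_of (Gamma p q 3 (1 + c) (-3) (-1 + c))
       (Gamma_gen p q 3 (1 + c) (-3) (-1 + c) S1) (Gamma_gen p q 3 (1 + c) (-3) (-1 + c) S2) X"
proof -
  interpret tight_rotation_group \<Gamma> s1 s2 "nat p" "nat q" by (rule tight_rotation_group_\<Gamma>)
  show ?thesis unfolding Gamma_def Gamma_gen_def rels_def[symmetric]
    using polyhedron_X chiral_X tight_X is_aut_group_of_X by blast
qed

end

text \<open>All conditions compare exponents of 2: \<beta> >= \<alpha> + 1 makes p divide 2c,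
  \<alpha> >= 3 makes 2q divide c*p, and \<beta> >= 5 makes 2q divide c*c. The sign s covers both
  groups.\<close>

lemma gamma_parameters_power_of_2:
  fixes \<alpha> \<beta> :: nat and s :: int
  assumes "\<beta> \<ge> \<alpha> + 1" and "\<alpha> \<ge> 3" and "\<beta> \<ge> 5" and s: "s = 1 \<or> s = -1"
  shows "gamma_parameters (2 ^ \<alpha>) (2 ^ \<beta>) (s * 2 ^ (\<beta> - 2))"
proof
  have dvd: "(2 :: int) ^ m dvd 2 ^ n" if "m \<le> n" for m n :: nat using that by (rule le_imp_power_dvd)
  have c: "2 * (s * 2 ^ (\<beta> - 2)) = s * 2 ^ (\<beta> - 1)"
    using assms by (simp add: power_Suc[symmetric] Suc_diff_Suc numeral_2_eq_2 del: power_Suc)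
  have q: "2 * (2 :: int) ^ \<beta> = 2 ^ (\<beta> + 1)" by simp
  show "(2 :: int) ^ \<alpha> dvd 2 * (s * 2 ^ (\<beta> - 2))"
    unfolding c using assms by (intro dvd_mult dvd) simp
  show "(2 :: int) ^ \<alpha> dvd 2 * 2 ^ \<beta>" unfolding q using assms by (intro dvd) simp
  have "s * 2 ^ (\<beta> - 2) * 2 ^ \<alpha> = s * (2 :: int) ^ (\<beta> - 2 + \<alpha>)" by (simp add: power_add)
  then show "2 * (2 :: int) ^ \<beta> dvd s * 2 ^ (\<beta> - 2) * 2 ^ \<alpha>"
    unfolding q using assms by (simp only:) (intro dvd_mult dvd, simp)
  have "s * 2 ^ (\<beta> - 2) * (s * 2 ^ (\<beta> - 2)) = (2 :: int) ^ (\<beta> - 2 + (\<beta> - 2))"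
    using s by (auto simp: power_add)
  then show "2 * (2 :: int) ^ \<beta> dvd s * 2 ^ (\<beta> - 2) * (s * 2 ^ (\<beta> - 2))"
    unfolding q using assms by (simp only:) (intro dvd, simp)
  have "\<not> (2 :: int) ^ \<beta> dvd 2 ^ (\<beta> - 1)"
    using assms by (simp add: zdvd_not_zless)
  then show "\<not> (2 :: int) ^ \<beta> dvd 2 * (s * 2 ^ (\<beta> - 2))"
    unfolding c using s by auto
qed (use assms in auto)

theorem theorem3p10:
  fixes \<alpha> \<beta> :: nat
  assumes "\<beta> \<ge> \<alpha> + 1" and "\<alpha> \<ge> 3" and "\<beta> \<ge> 5"
  shows "(\<exists>X :: nat ranked_poset.
            polyhedron X \<and> chiral X \<and> tight X (2 ^ \<alpha>) (2 ^ \<beta>) \<and>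
            is_aut_group_of
              (Gamma (2 ^ \<alpha>) (2 ^ \<beta>) 3 (1 + 2 ^ (\<beta> - 2)) (-3) (-1 + 2 ^ (\<beta> - 2)))
              (Gamma_gen (2 ^ \<alpha>) (2 ^ \<beta>) 3 (1 + 2 ^ (\<beta> - 2)) (-3) (-1 + 2 ^ (\<beta> - 2)) S1)
              (Gamma_gen (2 ^ \<alpha>) (2 ^ \<beta>) 3 (1 + 2 ^ (\<beta> - 2)) (-3) (-1 + 2 ^ (\<beta> - 2)) S2)
              X) \<and>
         (\<exists>X :: nat ranked_poset.
            polyhedron X \<and> chiral X \<and> tight X (2 ^ \<alpha>) (2 ^ \<beta>) \<and>
            is_aut_group_of
              (Gamma (2 ^ \<alpha>) (2 ^ \<beta>) 3 (1 - 2 ^ (\<beta> - 2)) (-3) (-1 - 2 ^ (\<beta> - 2)))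
              (Gamma_gen (2 ^ \<alpha>) (2 ^ \<beta>) 3 (1 - 2 ^ (\<beta> - 2)) (-3) (-1 - 2 ^ (\<beta> - 2)) S1)
              (Gamma_gen (2 ^ \<alpha>) (2 ^ \<beta>) 3 (1 - 2 ^ (\<beta> - 2)) (-3) (-1 - 2 ^ (\<beta> - 2)) S2)
              X)"
  using gamma_parameters.Gamma_tight_chiral[OF gamma_parameters_power_of_2[OF assms, of 1]]
    gamma_parameters.Gamma_tight_chiral[OF gamma_parameters_power_of_2[OF assms, of "-1"]]
  by (simp add: nat_power_eq)

end
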